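(* Let $\Phi=(G,\varphi)$ be a finite complex unit gain graph of order $n$ (without loops and multiple edges). Then $r(\Phi)=r(G)+2\theta(G)$ if and only if all of the following hold: (i) the cycles (if any) of $G$ are pairwise vertex-disjoint; (ii) each cycle $C_p^{\varphi}$ of $\Phi$ is of Type B and has order $p\equiv 0 \pmod 4$; (iii) a series of $\delta$-transformations can transform $G$ into a crucial subgraph $G_0$ that is the disjoint union of $\theta(G)$ cycles together with some isolated vertices.
   Context: A complex unit gain graph $\Phi=(G,\varphi)$ consists of a finite simple graph $G$ (the underlying graph) with vertex set $\{v_1,\dots,v_n\}$ and a gain function $\varphi$ assigning to each oriented edge $e_{ij}$ (from $v_i$ to $v_j$, where $v_iv_j\in E(G)$) a complex number of modulus $1$, with $\varphi(e_{ji})=\overline{\varphi(e_{ij})}$. The adjacency matrix $A(\Phi)$ is the Hermitian matrix with $(i,j)$ entry $\varphi(e_{ij})$ if $v_iv_j\in E(G)$ and $0$ otherwise; $r(\Phi)$ is its rank, and $r(G)$ is the rank of the $0$-$1$ adjacency matrix of $G$. $\theta(G)=|E(G)|-|V(G)|+\omega(G)$, where $\omega(G)$ is the number of connected components. Subgraphs of $\Phi$ carry the gains of $\Phi$; a cycle $C_p^\varphi$ of $\Phi$ is a cycle of $G$ with its gains. For a gain cycle $C_p^{\varphi}$ with vertices $v_1,\dots,v_p$ in cyclic order, $\varphi(C_p)=\varphi(e_{12})\varphi(e_{23})\cdots\varphi(e_{p1})$; for $p$ even it is of Type B if $\varphi(C_p)\neq(-1)^{p/2}$. A $\delta$-transformation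 of a graph with a pendant vertex (vertex of degree $1$) deletes a pendant vertex together with its unique neighbour. A crucial subgraph of $G$ is a graph without pendant vertices obtained from $G$ by a series of $\delta$-transformations. *)

theory Defs
  imports "HOL-Analysis.Analysis"
begin

text \<open>Graphs: vertices are the elements of a finite type 'n (so the order is CARD('n));
  adjacency is a symmetric irreflexive relation E. Subgraphs arising from
  delta-transformations are induced subgraphs on a vertex subset S.\<close>

definition simple_graph :: "('n \<Rightarrow> 'n \<Rightarrow> bool) \<Rightarrow> bool" where
  "simple_graph E \<longleftrightarrow> (\<forall>u v. E u v \<longrightarrow> E v u) \<and> (\<forall>v. \<not> E v v)"

definition gain_function :: "('n \<Rightarrow> 'n \<Rightarrow> bool) \<Rightarrow> ('n \<Rightarrow> 'n \<Rightarrow> complex) \<Rightarrow> bool" where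
  "gain_function E \<phi> \<longleftrightarrow> (\<forall>u v. E u v \<longrightarrow> cmod (\<phi> u v) = 1 \<and> \<phi> v u = cnj (\<phi> u v))"

definition gain_adj :: "('n::finite \<Rightarrow> 'n \<Rightarrow> bool) \<Rightarrow> ('n \<Rightarrow> 'n \<Rightarrow> complex) \<Rightarrow> complex^'n^'n" where
  "gain_adj E \<phi> = (\<chi> i j. if E i j then \<phi> i j else 0)"

definition adj :: "('n::finite \<Rightarrow> 'n \<Rightarrow> bool) \<Rightarrow> real^'n^'n" where
  "adj E = (\<chi> i j. if E i j then 1 else 0)"

definition edges :: "('n \<Rightarrow> 'n \<Rightarrow> bool) \<Rightarrow> 'n set set" where
  "edges E = {{u, v} | u v. E u v}"

definition num_components :: "('n \<Rightarrow> 'n \<Rightarrow> bool) \<Rightarrow> 'n set \<Rightarrow> nat" where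
  "num_components E S =
     card (S // {(u, v). u \<in> S \<and> v \<in> S \<and> (\<lambda>x y. E x y \<and> x \<in> S \<and> y \<in> S)\<^sup>*\<^sup>* u v})"

definition theta :: "('n::finite \<Rightarrow> 'n \<Rightarrow> bool) \<Rightarrow> int" where
  "theta E = int (card (edges E)) - int (card (UNIV :: 'n set)) + int (num_components E UNIV)"

definition is_cycle :: "('n \<Rightarrow> 'n \<Rightarrow> bool) \<Rightarrow> 'n list \<Rightarrow> bool" where
  "is_cycle E c \<longleftrightarrow> length c \<ge> 3 \<and> distinct c \<and>
     (\<forall>i < length c. E (c ! i) (c ! ((i + 1) mod length c)))"

definition cycle_edges :: "'n list \<Rightarrow> 'n set set" where
  "cycle_edges c = {{c ! i, c ! ((i + 1) mod length c)} | i. i < length c}"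

definition cycle_gain :: "('n \<Rightarrow> 'n \<Rightarrow> complex) \<Rightarrow> 'n list \<Rightarrow> complex" where
  "cycle_gain \<phi> c = (\<Prod>i < length c. \<phi> (c ! i) (c ! ((i + 1) mod length c)))"

definition type_B :: "('n \<Rightarrow> 'n \<Rightarrow> complex) \<Rightarrow> 'n list \<Rightarrow> bool" where
  "type_B \<phi> c \<longleftrightarrow> even (length c) \<and> cycle_gain \<phi> c \<noteq> (-1) ^ (length c div 2)"

definition deg_in :: "('n \<Rightarrow> 'n \<Rightarrow> bool) \<Rightarrow> 'n set \<Rightarrow> 'n \<Rightarrow> nat" where
  "deg_in E S v = card {u \<in> S. E v u}"

definition pendant_in :: "('n \<Rightarrow> 'n \<Rightarrow> bool) \<Rightarrow> 'n set \<Rightarrow> 'n \<Rightarrow> bool" where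
  "pendant_in E S v \<longleftrightarrow> v \<in> S \<and> deg_in E S v = 1"

definition delta_step :: "('n \<Rightarrow> 'n \<Rightarrow> bool) \<Rightarrow> 'n set \<Rightarrow> 'n set \<Rightarrow> bool" where
  "delta_step E S S' \<longleftrightarrow>
     (\<exists>v u. pendant_in E S v \<and> u \<in> S \<and> E v u \<and> S' = S - {v, u})"

definition crucial_subgraph :: "('n \<Rightarrow> 'n \<Rightarrow> bool) \<Rightarrow> 'n set \<Rightarrow> bool" where
  "crucial_subgraph E S0 \<longleftrightarrow> (delta_step E)\<^sup>*\<^sup>* UNIV S0 \<and> (\<forall>v. \<not> pendant_in E S0 v)"

definition cycles_plus_isolated :: "('n \<Rightarrow> 'n \<Rightarrow> bool) \<Rightarrow> 'n set \<Rightarrow> nat \<Rightarrow> bool" where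
  "cycles_plus_isolated E S0 k \<longleftrightarrow>
     (\<exists>cs :: 'n list list. length cs = k \<and>
        (\<forall>c \<in> set cs. is_cycle E c \<and> set c \<subseteq> S0) \<and>
        (\<forall>i < k. \<forall>j < k. i \<noteq> j \<longrightarrow> set (cs ! i) \<inter> set (cs ! j) = {}) \<and>
        {{u, v} | u v. E u v \<and> u \<in> S0 \<and> v \<in> S0} = (\<Union>c \<in> set cs. cycle_edges c))"

end

theory Submission
  imports Defs
begin

text \<open>Deleting a vertex on a cycle lowers \<open>\<theta>\<close> by at least one, the rank of
  \<open>\<Phi>\<close> by at most two, and does not raise the rank of \<open>G\<close>; hence
  \<open>r(\<Phi>) \<le> r(G) + 2\<theta>(G)\<close>, with \<open>r(\<Phi>) = r(G)\<close> for forests. If equality holds, every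
  such deletion lowers \<open>\<theta>\<close> by exactly one, which makes the cycles disjoint, and every
  \<open>\<delta>\<close>-transformation keeps equality and avoids the cycles.

  That an extremal graph without pendant vertices is a union of cycles and isolated vertices
  follows by counting: the nullity of any graph satisfies
  \<open>2\<eta>(G) \<le> (\<Sum>v. \<bar>deg v - 2\<bar>) + 2\<theta>(G) + 2b(G)\<close>, where \<open>b\<close> counts the components that are
  single cycles. Combined with \<open>\<eta>(G) = \<eta>(\<Phi>) + 2\<theta>(G)\<close> and the handshake lemma, this bounds the
  number of components by the number of isolated vertices plus \<open>b\<close>.

  On a cycle that is a whole component, explicit alternating vectors decide how the rank changes
  when one of its vertices is deleted: type B lowers it by two, type A leaves it unchanged.

  Vertex deletion is modelled by isolating the vertex: an isolated vertex contributes neither to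
  the ranks nor to \<open>\<theta>\<close>, so all graphs live on the same vertex type.\<close>

section \<open>Rank under deletion of a row and a column\<close>

text \<open>Expanding every row in a basis \<open>B\<close> of the row space factors
  \<open>A\<close> through \<open>card B\<close> coefficient vectors, and these span all columns.
  The argument is valid over any field, so it serves the complex and the real matrix alike.\<close>

lemma dim_columns_le_dim_rows:
  fixes A :: "'a::field^'n^'m"
  shows "vec.dim (columns A) \<le> vec.dim (rows A)"
proof -
  obtain B where B: "B \<subseteq> rows A" "vec.independent B" "rows A \<subseteq> vec.span B"
      "card B = vec.dim (rows A)"
    using vec.basis_exists by blast
  have fin: "finite B"
    using B(2) by (rule vec.finiteI_independent)
  have "\<exists>c. \<forall>i. row i A = (\<Sum>b\<in>B. c i b *s b)"
  proof -
    have "\<exists>u. row i A = (\<Sum>b\<in>B. u b *s b)" for i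
    proof -
      have "row i A \<in> vec.span B"
        using B(3) by (auto simp: rows_def)
      then show ?thesis
        unfolding vec.span_finite[OF fin] by auto
    qed
    then show ?thesis by metis
  qed
  then obtain c where c: "row i A = (\<Sum>b\<in>B. c i b *s b)" for i by blast
  \<comment> \<open>One coefficient vector per basis vector; column \<open>j\<close> combines them
    with scalars \<open>b $ j\<close>.\<close>
  let ?C = "(\<lambda>b. \<chi> i. c i b) ` B"
  have "column j A \<in> vec.span ?C" for j
  proof -
    have "A $ i $ j = (\<Sum>b\<in>B. b $ j * c i b)" for i
    proof -
      have "A $ i $ j = row i A $ j" by (simp add: row_def)
      also have "\<dots> = (\<Sum>b\<in>B. b $ j * c i b)"
        unfolding c by (simp add: mult.commute)
      finally show ?thesis .
    qed
    then have "column j A = (\<Sum>b\<in>B. (b $ j) *s (\<chi> i. c i b))"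
      by (simp add: column_def vec_eq_iff)
    also have "\<dots> \<in> vec.span ?C"
      by (intro vec.span_sum vec.span_scale vec.span_base) auto
    finally show ?thesis .
  qed
  then have "columns A \<subseteq> vec.span ?C" by (auto simp: columns_def)
  then have "vec.dim (columns A) \<le> card ?C"
    using fin by (intro vec.dim_le_card) auto
  also have "\<dots> \<le> card B" by (rule card_image_le[OF fin])
  finally show ?thesis using B(4) by simp
qed

lemma rank_transpose_field:
  fixes A :: "'a::field^'n^'m"
  shows "rank (transpose A) = rank A"
  using dim_columns_le_dim_rows[of A] dim_columns_le_dim_rows[of "transpose A"]
  by (simp add: row_rank_def_gen)

section \<open>Rank when one row or one column is zeroed\<close>

definition zero_row :: "'n::finite \<Rightarrow> 'a::field^'n^'n \<Rightarrow> 'a^'n^'n" where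
  "zero_row x M = (\<chi> i j. if i = x then 0 else M $ i $ j)"

definition zero_col :: "'n::finite \<Rightarrow> 'a::field^'n^'n \<Rightarrow> 'a^'n^'n" where
  "zero_col x M = (\<chi> i j. if j = x then 0 else M $ i $ j)"

lemma transpose_zero_col: "transpose (zero_col x M) = zero_row x (transpose M)"
  by (simp add: zero_col_def zero_row_def transpose_def vec_eq_iff)

lemma rows_zero_row: "rows (zero_row x M) = insert 0 ((\<lambda>i. row i M) ` (- {x}))"
proof -
  have "row i (zero_row x M) = (if i = x then 0 else row i M)" for i
    by (simp add: row_def zero_row_def vec_eq_iff)
  then show ?thesis
    unfolding rows_def by auto
qed

text \<open>The zeroed row contributes only the vector 0 to the span, so the rank changes exactly
  when row \<open>x\<close> is independent of the others.\<close>

lemma rank_zero_row_cases: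
  "rank M = (if row x M \<in> vec.span ((\<lambda>i. row i M) ` (- {x}))
     then rank (zero_row x M) else rank (zero_row x M) + 1)"
proof -
  have "rows M = insert (row x M) ((\<lambda>i. row i M) ` (- {x}))"
    unfolding rows_def by auto
  then show ?thesis
    by (simp add: row_rank_def_gen rows_zero_row vec.dim_insert vec.span_zero)
qed

lemma rank_zero_row_le: "rank (zero_row x M) \<le> rank M"
  and rank_le_zero_row: "rank M \<le> rank (zero_row x M) + 1"
  using rank_zero_row_cases[of M x] by (auto split: if_splits)

lemma rank_zero_col_le: "rank (zero_col x M) \<le> rank M"
  and rank_le_zero_col: "rank M \<le> rank (zero_col x M) + 1"
  by (metis rank_transpose_field transpose_zero_col rank_zero_row_le,
      metis rank_transpose_field transpose_zero_col rank_le_zero_row)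

text \<open>The functional pairing a row with \<open>u\<close> kills every row except row
  \<open>x\<close>, where it is 1. Hence row \<open>x\<close> is not in the span of the
  others.\<close>

lemma rank_zero_row_axis:
  assumes "M *v u = axis x 1"
  shows "rank M = rank (zero_row x M) + 1"
proof -
  have "row x M \<notin> vec.span ((\<lambda>i. row i M) ` (- {x}))"
  proof
    let ?f = "\<lambda>r. \<Sum>j\<in>UNIV. r $ j * u $ j"
    have f: "?f (row i M) = axis x 1 $ i" for i
      using assms by (simp add: matrix_vector_mult_def row_def vec_eq_iff)
    have sub: "vec.subspace {r. ?f r = 0}"
      unfolding vec.subspace_def
      by (simp add: distrib_right sum.distrib mult.assoc flip: sum_distrib_left)
    assume "row x M \<in> vec.span ((\<lambda>i. row i M) ` (- {x}))"
    moreover have "(\<lambda>i. row i M) ` (- {x}) \<subseteq> {r. ?f r = 0}"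
      using f by (auto simp: axis_def)
    ultimately have "?f (row x M) = 0"
      using vec.span_minimal[OF _ sub] by blast
    then show False using f[of x] by (simp add: axis_def)
  qed
  then show ?thesis using rank_zero_row_cases[of M x] by simp
qed

text \<open>A left kernel vector is a linear relation between the rows; a nonzero entry at
  \<open>x\<close> lets it be solved for row \<open>x\<close>.\<close>

lemma rank_zero_row_kernel:
  assumes "transpose M *v u = 0" "u $ x \<noteq> 0"
  shows "rank M = rank (zero_row x M)"
proof -
  have "(\<Sum>i\<in>UNIV. u $ i *s row i M) = 0"
    using assms(1) by (simp add: matrix_vector_mult_def transpose_def row_def vec_eq_iff mult.commute)
  then have "u $ x *s row x M + (\<Sum>i\<in>-{x}. u $ i *s row i M) = 0"
    by (subst (asm) sum.remove[of _ x]) (auto simp: Compl_eq_Diff_UNIV)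
  then have "u $ x *s row x M = - (\<Sum>i\<in>-{x}. u $ i *s row i M)"
    by (simp add: eq_neg_iff_add_eq_0)
  moreover have "- (\<Sum>i\<in>-{x}. u $ i *s row i M) \<in> vec.span ((\<lambda>i. row i M) ` (- {x}))"
    by (intro vec.span_neg vec.span_sum vec.span_scale vec.span_base) auto
  ultimately have "inverse (u $ x) *s (u $ x *s row x M) \<in> vec.span ((\<lambda>i. row i M) ` (- {x}))"
    by (metis vec.span_scale)
  then have "row x M \<in> vec.span ((\<lambda>i. row i M) ` (- {x}))"
    using assms(2) by (simp add: vector_smult_assoc)
  then show ?thesis using rank_zero_row_cases[of M x] by simp
qed

lemma zero_row_mult:
  assumes "M *v u = (axis x c :: 'a::field^'n)"
  shows "zero_row x M *v u = 0"
proof -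
  have "(zero_row x M *v u) $ i = (if i = x then 0 else (M *v u) $ i)" for i
    by (simp add: zero_row_def matrix_vector_mult_def)
  then show ?thesis using assms by (simp add: vec_eq_iff axis_def)
qed

lemma zero_col_mult: "u $ x = 0 \<Longrightarrow> zero_col x M *v u = M *v u"
  by (auto simp: zero_col_def matrix_vector_mult_def vec_eq_iff intro!: sum.cong)

definition del_idx :: "'n::finite \<Rightarrow> 'a::field^'n^'n \<Rightarrow> 'a^'n^'n" where
  "del_idx x M = zero_row x (zero_col x M)"

lemma rank_del_idx_le: "rank (del_idx x M) \<le> rank M"
  unfolding del_idx_def using rank_zero_row_le rank_zero_col_le le_trans by blast

lemma rank_le_del_idx: "rank M \<le> rank (del_idx x M) + 2"
  using rank_le_zero_row[of "zero_col x M" x] rank_le_zero_col[of M x]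
  unfolding del_idx_def by simp

lemma rank_del_idx_axis:
  assumes "transpose M *v u = axis x 1"
  shows "rank (del_idx x M) + 1 \<le> rank M"
proof -
  have "rank M = rank (zero_col x M) + 1"
    using rank_zero_row_axis[OF assms] by (metis rank_transpose_field transpose_zero_col)
  then show ?thesis
    unfolding del_idx_def using rank_zero_row_le[of x "zero_col x M"] by simp
qed

text \<open>The column goes first, by \<open>u\<close>, then the row, by \<open>v\<close>. Since
  \<open>v $ x = 0\<close>, zeroing the column does not disturb the image of \<open>v\<close>, and
  each of the two steps costs one rank.\<close>

lemma rank_del_idx_axis2:
  assumes "transpose M *v u = axis x 1" "M *v v = axis x 1" "v $ x = 0"
  shows "rank M = rank (del_idx x M) + 2"
proof -
  have "rank M = rank (zero_col x M) + 1"
    using rank_zero_row_axis[OF assms(1)] by (metis rank_transpose_field transpose_zero_col)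
  moreover have "rank (zero_col x M) = rank (del_idx x M) + 1"
    unfolding del_idx_def
    by (rule rank_zero_row_axis[where u = v]) (simp add: zero_col_mult assms)
  ultimately show ?thesis by simp
qed

lemma rank_del_idx_kernel:
  assumes "transpose M *v u = 0" "u $ x \<noteq> 0" "M *v v = 0" "v $ x \<noteq> 0"
  shows "rank (del_idx x M) = rank M"
proof -
  have "transpose (transpose M) *v v = 0" using assms(3) by simp
  from rank_zero_row_kernel[OF this assms(4)]
  have 1: "rank M = rank (zero_col x M)"
    by (metis rank_transpose_field transpose_zero_col)
  \<comment> \<open>The left kernel vector \<open>u\<close> survives the zeroing of the column: this
    is \<open>zero_row_mult\<close> for the transpose with \<open>c = 0\<close>.\<close>
  have "transpose (zero_col x M) *v u = 0"
    using zero_row_mult[of "transpose M" u x 0] assms(1)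
    by (simp add: transpose_zero_col axis_def vec_eq_iff)
  from rank_zero_row_kernel[OF this assms(2)] show ?thesis
    using 1 by (simp add: del_idx_def)
qed

section \<open>Cyclomatic number and connected components\<close>

definition restr :: "('n \<Rightarrow> 'n \<Rightarrow> bool) \<Rightarrow> 'n set \<Rightarrow> 'n \<Rightarrow> 'n \<Rightarrow> bool" where
  "restr E S u v \<longleftrightarrow> E u v \<and> u \<in> S \<and> v \<in> S"

definition add_edge :: "('n \<Rightarrow> 'n \<Rightarrow> bool) \<Rightarrow> 'n \<Rightarrow> 'n \<Rightarrow> 'n \<Rightarrow> 'n \<Rightarrow> bool" where
  "add_edge E a b u v \<longleftrightarrow> E u v \<or> {u, v} = {a, b}"

definition deg :: "('n \<Rightarrow> 'n \<Rightarrow> bool) \<Rightarrow> 'n \<Rightarrow> nat" where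
  "deg E v = card {u. E v u}"

definition conn_classes :: "('n \<Rightarrow> 'n \<Rightarrow> bool) \<Rightarrow> 'n set set" where
  "conn_classes E = range (\<lambda>u. {v. E\<^sup>*\<^sup>* u v})"

text \<open>A cycle seen locally from its vertex \<open>x\<close>: a walk from \<open>a\<close> to
  \<open>b\<close> that avoids \<open>x\<close> closes up through \<open>x\<close>. This spares
  explicit vertex lists in the counting arguments.\<close>

definition cyclic_at :: "('n \<Rightarrow> 'n \<Rightarrow> bool) \<Rightarrow> 'n \<Rightarrow> 'n \<Rightarrow> 'n \<Rightarrow> bool" where
  "cyclic_at E x a b \<longleftrightarrow> E x a \<and> E x b \<and> a \<noteq> b \<and> (restr E (- {x}))\<^sup>*\<^sup>* a b"

lemma simple_graph_sym: "simple_graph E \<Longrightarrow> E u v \<Longrightarrow> E v u"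
  and simple_graph_irrefl: "simple_graph E \<Longrightarrow> \<not> E v v"
  and simple_graph_neq: "simple_graph E \<Longrightarrow> E u v \<Longrightarrow> u \<noteq> v"
  by (auto simp: simple_graph_def)

lemma simple_graph_restr: "simple_graph E \<Longrightarrow> simple_graph (restr E S)"
  by (auto simp: simple_graph_def restr_def)

lemma simple_graph_add_edge: "simple_graph E \<Longrightarrow> a \<noteq> b \<Longrightarrow> simple_graph (add_edge E a b)"
  by (auto simp: simple_graph_def add_edge_def doubleton_eq_iff)

lemma restr_UNIV [simp]: "restr E UNIV = E"
  by (simp add: restr_def fun_eq_iff)

lemma conn_sym: "simple_graph E \<Longrightarrow> E\<^sup>*\<^sup>* u v \<Longrightarrow> E\<^sup>*\<^sup>* v u"
  by (rule sympD[OF symp_rtranclp]) (simp_all add: symp_def simple_graph_def)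

section \<open>The cyclomatic number under addition of edges\<close>

lemma theta_conn_classes:
  "theta E = int (card (edges E)) - int (CARD('n)) + int (card (conn_classes E))"
  for E :: "'n::finite \<Rightarrow> 'n \<Rightarrow> bool"
proof -
  have "UNIV // {(u, v). E\<^sup>*\<^sup>* u v} = conn_classes E"
    by (auto simp: quotient_def conn_classes_def Image_def)
  then show ?thesis by (simp add: theta_def num_components_def)
qed

lemma rtranclp_mono_le: "(\<And>u v. R u v \<Longrightarrow> S u v) \<Longrightarrow> R\<^sup>*\<^sup>* u v \<Longrightarrow> S\<^sup>*\<^sup>* u v"
  using rtranclp_mono[of R S] by blast

lemma rtranclp_add_edge:
  assumes "simple_graph E" "a \<noteq> b"
  shows "(add_edge E a b)\<^sup>*\<^sup>* u v \<longleftrightarrow>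
    E\<^sup>*\<^sup>* u v \<or> ((E\<^sup>*\<^sup>* a u \<or> E\<^sup>*\<^sup>* b u) \<and> (E\<^sup>*\<^sup>* a v \<or> E\<^sup>*\<^sup>* b v))" (is "?L u v = ?R u v")
proof
  assume "?L u v"
  then show "?R u v"
  proof (induction rule: rtranclp_induct)
    case (step y z)
    from step.hyps(2) consider "E y z" | "y = a" "z = b" | "y = b" "z = a"
      by (auto simp: add_edge_def doubleton_eq_iff)
    then show ?case
    proof cases
      case 1
      then show ?thesis using step.IH by (meson rtranclp.rtrancl_into_rtrancl)
    next
      case 2
      then show ?thesis using step.IH conn_sym[OF assms(1)] by blast
    next
      case 3
      then show ?thesis using step.IH conn_sym[OF assms(1)] by blast
    qed
  qed simp
next
  have E: "E\<^sup>*\<^sup>* s t \<Longrightarrow> ?L s t" for s t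
    by (rule rtranclp_mono_le[of E]) (auto simp: add_edge_def)
  have ab: "?L a b" by (rule r_into_rtranclp) (simp add: add_edge_def)
  have sym: "?L s t \<Longrightarrow> ?L t s" for s t
    by (rule conn_sym[OF simple_graph_add_edge[OF assms]])
  have a: "?L a s" if "E\<^sup>*\<^sup>* a s \<or> E\<^sup>*\<^sup>* b s" for s
    using that E rtranclp_trans[OF ab] by blast
  assume "?R u v"
  then show "?L u v"
    using E a[of u, THEN sym] a[of v] rtranclp_trans[of "add_edge E a b" u a v] by blast
qed

lemma component_eq_iff:
  assumes "simple_graph E"
  shows "{w. E\<^sup>*\<^sup>* u w} = {w. E\<^sup>*\<^sup>* v w} \<longleftrightarrow> E\<^sup>*\<^sup>* u v"
proof
  assume "{w. E\<^sup>*\<^sup>* u w} = {w. E\<^sup>*\<^sup>* v w}"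
  then show "E\<^sup>*\<^sup>* u v" by blast
next
  assume "E\<^sup>*\<^sup>* u v"
  then show "{w. E\<^sup>*\<^sup>* u w} = {w. E\<^sup>*\<^sup>* v w}"
    using conn_sym[OF assms] by (blast intro: rtranclp_trans)
qed

lemma component_eq:
  assumes "simple_graph E" "K \<in> conn_classes E" "v \<in> K"
  shows "K = {w. E\<^sup>*\<^sup>* v w}"
  using assms component_eq_iff[OF assms(1)] by (auto simp: conn_classes_def)

text \<open>An edge inside a component leaves the components alone, while an edge between two
  components merges them, which cancels the extra edge in \<open>theta\<close>.\<close>

lemma theta_add_edge:
  fixes E :: "'n::finite \<Rightarrow> 'n \<Rightarrow> bool"
  assumes "simple_graph E" "a \<noteq> b" "\<not> E a b"
  shows "theta (add_edge E a b) = theta E + (if E\<^sup>*\<^sup>* a b then 1 else 0)"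
proof -
  let ?A = "add_edge E a b"
  have "edges ?A = insert {a, b} (edges E)"
    unfolding edges_def add_edge_def by auto
  moreover have "{a, b} \<notin> edges E"
    using assms by (auto simp: edges_def doubleton_eq_iff dest: simple_graph_sym)
  ultimately have e: "card (edges ?A) = card (edges E) + 1"
    by simp
  show ?thesis
  proof (cases "E\<^sup>*\<^sup>* a b")
    case True
    have a: "E\<^sup>*\<^sup>* a s" if "E\<^sup>*\<^sup>* a s \<or> E\<^sup>*\<^sup>* b s" for s
      using that rtranclp_trans[OF True] by blast
    have "?A\<^sup>*\<^sup>* u v \<longleftrightarrow> E\<^sup>*\<^sup>* u v" for u v
      unfolding rtranclp_add_edge[OF assms(1,2)]
      using conn_sym[OF assms(1) a[of u]] a[of v] rtranclp_trans[of E u a v] by blast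
    then have "conn_classes ?A = conn_classes E" by (simp add: conn_classes_def)
    then show ?thesis using e True by (simp add: theta_conn_classes)
  next
    case False
    define Ka where "Ka = {w. E\<^sup>*\<^sup>* a w}"
    define Kb where "Kb = {w. E\<^sup>*\<^sup>* b w}"
    \<comment> \<open>The classes untouched by the merger; both partitions are \<open>D\<close> plus
      one or two further classes.\<close>
    define D where "D = conn_classes E - {Ka, Kb}"
    have class_A: "{w. ?A\<^sup>*\<^sup>* u w} = (if u \<in> Ka \<union> Kb then Ka \<union> Kb else {w. E\<^sup>*\<^sup>* u w})" for u
    proof (cases "u \<in> Ka \<union> Kb")
      case True
      then have "w \<in> Ka \<union> Kb" if "E\<^sup>*\<^sup>* u w" for w
        using that rtranclp_trans[of E _ u w] by (auto simp: Ka_def Kb_def)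
      then show ?thesis
        using True unfolding rtranclp_add_edge[OF assms(1,2)] Ka_def Kb_def by auto
    next
      case False
      then show ?thesis
        unfolding rtranclp_add_edge[OF assms(1,2)] Ka_def Kb_def by auto
    qed
    have K_eq: "{w. E\<^sup>*\<^sup>* u w} = Ka \<longleftrightarrow> u \<in> Ka" "{w. E\<^sup>*\<^sup>* u w} = Kb \<longleftrightarrow> u \<in> Kb" for u
      using component_eq_iff[OF assms(1), of _ u] by (auto simp: Ka_def Kb_def)
    have D: "D = (\<lambda>u. {w. E\<^sup>*\<^sup>* u w}) ` (- (Ka \<union> Kb))"
      unfolding D_def conn_classes_def using K_eq by blast
    have "conn_classes ?A = insert (Ka \<union> Kb) D"
    proof -
      have "a \<in> Ka" by (simp add: Ka_def)
      then show ?thesis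
        unfolding conn_classes_def class_A D by (auto simp: image_iff)
    qed
    moreover have "Ka \<union> Kb \<notin> D"
      unfolding D Ka_def Kb_def by auto
    moreover have "conn_classes E = insert Ka (insert Kb D)"
      unfolding D_def conn_classes_def Ka_def Kb_def by auto
    moreover have "Ka \<noteq> Kb"
      using False component_eq_iff[OF assms(1)] by (simp add: Ka_def Kb_def)
    moreover have "Ka \<notin> D" "Kb \<notin> D" "finite D" by (auto simp: D_def)
    ultimately show ?thesis using e False by (simp add: theta_conn_classes)
  qed
qed

lemma simple_graph_induct [consumes 1, case_names empty add]:
  fixes E :: "'n::finite \<Rightarrow> 'n \<Rightarrow> bool"
  assumes "simple_graph E"
    and "P (\<lambda>_ _. False)"
    and add: "\<And>E a b. simple_graph E \<Longrightarrow> a \<noteq> b \<Longrightarrow> \<not> E a b \<Longrightarrow> P E \<Longrightarrow> P (add_edge E a b)"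
  shows "P E"
  using assms(1)
proof (induction "card (edges E)" arbitrary: E rule: less_induct)
  case less
  show ?case
  proof (cases "E = (\<lambda>_ _. False)")
    case True
    then show ?thesis using assms(2) by simp
  next
    case False
    then obtain a b where ab: "E a b" by (auto simp: fun_eq_iff)
    \<comment> \<open>Both orientations of the edge are removed, so that \<open>D\<close> remains
      symmetric.\<close>
    define D where "D = (\<lambda>u v. E u v \<and> {u, v} \<noteq> {a, b})"
    have "edges D \<subseteq> edges E - {{a, b}}" unfolding edges_def D_def by auto
    moreover have "{a, b} \<in> edges E" using ab by (auto simp: edges_def)
    ultimately have "card (edges D) < card (edges E)"
      by (intro psubset_card_mono) auto
    moreover have "simple_graph D"
      using less.prems by (auto simp: simple_graph_def D_def doubleton_eq_iff)
    moreover have "add_edge D a b = E"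
      using ab simple_graph_sym[OF less.prems]
      by (auto simp: add_edge_def D_def fun_eq_iff doubleton_eq_iff)
    moreover have "a \<noteq> b" "\<not> D a b"
      using ab less.prems by (auto simp: D_def simple_graph_def)
    ultimately show ?thesis using add[of D a b] less.hyps by simp
  qed
qed

lemma theta_empty: "theta ((\<lambda>_ _. False) :: 'n::finite \<Rightarrow> 'n \<Rightarrow> bool) = 0"
proof -
  have "(\<lambda>_ _. False)\<^sup>*\<^sup>* u v \<longleftrightarrow> u = v" for u v :: 'n
    by (auto elim: rtranclp.cases)
  then have "conn_classes ((\<lambda>_ _. False) :: 'n \<Rightarrow> 'n \<Rightarrow> bool) = range (\<lambda>u. {u})"
    by (simp add: conn_classes_def)
  then show ?thesis
    by (simp add: theta_conn_classes edges_def card_image)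
qed

lemma theta_add_edge_ge:
  fixes E :: "'n::finite \<Rightarrow> 'n \<Rightarrow> bool"
  assumes "simple_graph E" "a \<noteq> b"
  shows "theta E \<le> theta (add_edge E a b)"
proof (cases "E a b")
  case True
  then have "add_edge E a b = E"
    using simple_graph_sym[OF assms(1)] by (auto simp: add_edge_def fun_eq_iff doubleton_eq_iff)
  then show ?thesis by simp
qed (simp add: theta_add_edge assms)

text \<open>The missing edges of \<open>F\<close> are added to \<open>E\<close> one at a time, and
  none of these additions lowers \<open>theta\<close>.\<close>

lemma theta_mono:
  fixes E :: "'n::finite \<Rightarrow> 'n \<Rightarrow> bool"
  assumes "simple_graph E" "simple_graph F" "\<And>u v. E u v \<Longrightarrow> F u v"
  shows "theta E \<le> theta F"
  using assms
proof (induction "card {(u, v). F u v \<and> \<not> E u v}" arbitrary: E rule: less_induct)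
  case less
  show ?case
  proof (cases "E = F")
    case False
    then obtain a b where ab: "F a b" "\<not> E a b"
      using less.prems(3) by (auto simp: fun_eq_iff)
    then have neq: "a \<noteq> b" using less.prems(2) by (auto simp: simple_graph_def)
    have "card {(u, v). F u v \<and> \<not> add_edge E a b u v} < card {(u, v). F u v \<and> \<not> E u v}"
      using ab by (intro psubset_card_mono) (auto simp: add_edge_def)
    moreover have "add_edge E a b u v \<Longrightarrow> F u v" for u v
      using ab less.prems simple_graph_sym[OF less.prems(2)]
      by (auto simp: add_edge_def doubleton_eq_iff)
    ultimately have "theta (add_edge E a b) \<le> theta F"
      using less.hyps simple_graph_add_edge[OF less.prems(1) neq] less.prems(2) by blast
    then show ?thesis using theta_add_edge_ge[OF less.prems(1) neq] by simp
  qed simp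
qed

lemma theta_nonneg: "simple_graph E \<Longrightarrow> 0 \<le> theta E"
  using theta_mono[of "\<lambda>_ _. False" E] by (simp add: theta_empty simple_graph_def)

lemma theta_restr_le: "simple_graph E \<Longrightarrow> theta (restr E S) \<le> theta E"
  by (intro theta_mono simple_graph_restr) (auto simp: restr_def)

section \<open>Cyclic pairs at a vertex\<close>

text \<open>Once the edge from \<open>x\<close> to \<open>a\<close> has been restored,
  \<open>x\<close> reaches \<open>b\<close>; restoring the edge from \<open>x\<close> to
  \<open>b\<close> will then close a cycle.\<close>

lemma rtranclp_through_new_edge:
  assumes "cyclic_at E x a b" "\<And>u v. restr E (- {x}) u v \<Longrightarrow> F u v" "F x a"
  shows "F\<^sup>*\<^sup>* x b"
proof -
  have "F\<^sup>*\<^sup>* a b"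
    by (rule rtranclp_mono_le[of "restr E (- {x})"])
      (use assms in \<open>auto simp: cyclic_at_def\<close>)
  then show ?thesis using assms(3) by (rule converse_rtranclp_into_rtranclp[rotated])
qed

lemma cyclic_at_commute: "simple_graph E \<Longrightarrow> cyclic_at E x a b \<Longrightarrow> cyclic_at E x b a"
  using conn_sym[OF simple_graph_restr] by (auto simp: cyclic_at_def)

text \<open>With \<open>x\<close> isolated, the edges to \<open>a\<close> and \<open>b\<close> are
  put back. The second one closes a cycle and raises \<open>theta\<close> by one, and the result is
  still a subgraph of \<open>E\<close>.\<close>

lemma theta_cyclic_drop:
  fixes E :: "'n::finite \<Rightarrow> 'n \<Rightarrow> bool"
  assumes "simple_graph E" "cyclic_at E x a b"
  shows "theta (restr E (- {x})) + 1 \<le> theta E"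
proof -
  let ?D = "restr E (- {x})"
  let ?D1 = "add_edge ?D x a"
  have neq: "x \<noteq> a" "x \<noteq> b" "a \<noteq> b" "E x a" "E x b"
    using assms by (auto simp: cyclic_at_def simple_graph_def)
  have s: "simple_graph ?D" "simple_graph ?D1"
    using assms(1) neq by (auto intro: simple_graph_restr simple_graph_add_edge)
  have "?D1\<^sup>*\<^sup>* x b"
    by (rule rtranclp_through_new_edge[OF assms(2)]) (auto simp: add_edge_def)
  moreover have "\<not> ?D1 x b"
    using neq by (auto simp: add_edge_def restr_def doubleton_eq_iff)
  ultimately have "theta (add_edge ?D1 x b) = theta ?D1 + 1"
    using s neq by (simp add: theta_add_edge)
  moreover have "theta (add_edge ?D1 x b) \<le> theta E"
    using s neq assms(1)
    by (intro theta_mono simple_graph_add_edge)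
      (auto simp: add_edge_def restr_def doubleton_eq_iff dest: simple_graph_sym)
  moreover have "theta ?D \<le> theta ?D1" using s neq by (simp add: theta_add_edge_ge)
  ultimately show ?thesis by simp
qed

text \<open>The edges from \<open>x\<close> to \<open>a\<close>, \<open>b\<close>, \<open>c\<close>,
  \<open>d\<close> are put back in this order. Those to \<open>b\<close> and \<open>d\<close> each
  close a cycle, provided that the one to \<open>d\<close> is really new; the one to
  \<open>c\<close> may already be there.\<close>

lemma theta_two_cyclic_drop:
  fixes E :: "'n::finite \<Rightarrow> 'n \<Rightarrow> bool"
  assumes "simple_graph E" "cyclic_at E x a b" "cyclic_at E x c d" "{a, b} \<noteq> {c, d}"
  shows "theta (restr E (- {x})) + 2 \<le> theta E"
proof -
  have main: "theta (restr E (- {x})) + 2 \<le> theta E"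
    if cd: "cyclic_at E x c d" "d \<notin> {a, b}" for c d
  proof -
    let ?D = "restr E (- {x})"
    let ?D1 = "add_edge ?D x a"
    let ?D2 = "add_edge ?D1 x b"
    let ?D3 = "add_edge ?D2 x c"
    have neq: "x \<noteq> a" "x \<noteq> b" "a \<noteq> b" "E x a" "E x b" "x \<noteq> c" "x \<noteq> d" "c \<noteq> d" "E x c" "E x d"
      using assms(1,2) cd by (auto simp: cyclic_at_def simple_graph_def)
    have s: "simple_graph ?D" "simple_graph ?D1" "simple_graph ?D2" "simple_graph ?D3"
      using assms(1) neq by (auto intro!: simple_graph_restr simple_graph_add_edge)
    have "?D1\<^sup>*\<^sup>* x b"
      by (rule rtranclp_through_new_edge[OF assms(2)]) (auto simp: add_edge_def)
    moreover have "\<not> ?D1 x b"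
      using neq by (auto simp: add_edge_def restr_def doubleton_eq_iff)
    ultimately have "theta ?D2 = theta ?D1 + 1"
      using s neq by (simp add: theta_add_edge)
    moreover have "?D3\<^sup>*\<^sup>* x d"
      by (rule rtranclp_through_new_edge[OF cd(1)]) (auto simp: add_edge_def)
    moreover have "\<not> ?D3 x d"
      using neq cd(2) by (auto simp: add_edge_def restr_def doubleton_eq_iff)
    ultimately have "theta (add_edge ?D3 x d) = theta ?D3 + 1" "theta ?D2 = theta ?D1 + 1"
      using s neq by (simp_all add: theta_add_edge)
    moreover have "theta (add_edge ?D3 x d) \<le> theta E"
      using s neq assms(1)
      by (intro theta_mono simple_graph_add_edge)
        (auto simp: add_edge_def restr_def doubleton_eq_iff dest: simple_graph_sym)
    moreover have "theta ?D \<le> theta ?D1" "theta ?D2 \<le> theta ?D3"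
      using s neq by (simp_all add: theta_add_edge_ge)
    ultimately show ?thesis by simp
  qed
  have "a \<noteq> b" "c \<noteq> d" using assms by (auto simp: cyclic_at_def)
  \<comment> \<open>Distinct two-element sets: one of \<open>c\<close>, \<open>d\<close> is new, and
    the pair may be swapped to make it the last one added.\<close>
  then have "d \<notin> {a, b} \<or> c \<notin> {a, b}" using assms(4) by auto
  then show ?thesis
    using main assms(3) cyclic_at_commute[OF assms(1)] by blast
qed

text \<open>Cuts a walk just before its first visit to \<open>a\<close>. The vertex
  \<open>a'\<close> found there supplies the second neighbour of a cyclic pair at
  \<open>a\<close>.\<close>

lemma rtranclp_first_hit:
  assumes "E\<^sup>*\<^sup>* b c"
  shows "b = a \<or> c \<noteq> a \<and> (restr E (- {a}))\<^sup>*\<^sup>* b c \<or> (\<exists>a'. (restr E (- {a}))\<^sup>*\<^sup>* b a' \<and> a' \<noteq> a \<and> E a' a)"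
  using assms
proof (induction rule: rtranclp_induct)
  case (step y z)
  show ?case
  proof (cases "b = a \<or> (\<exists>a'. (restr E (- {a}))\<^sup>*\<^sup>* b a' \<and> a' \<noteq> a \<and> E a' a)")
    case False
    then have y: "y \<noteq> a" "(restr E (- {a}))\<^sup>*\<^sup>* b y" using step.IH by auto
    show ?thesis
    proof (cases "z = a")
      case True
      then show ?thesis using y step.hyps by blast
    next
      case False
      then have "restr E (- {a}) y z" using y step.hyps by (simp add: restr_def)
      then show ?thesis using y False by (meson rtranclp.rtrancl_into_rtrancl)
    qed
  qed blast
qed auto

text \<open>Moves the base point one step along the cycle: the walk from \<open>b\<close> to
  \<open>a\<close> avoiding \<open>x\<close> first enters \<open>a\<close> from some
  \<open>a'\<close>, and \<open>x\<close> followed by the walk from \<open>b\<close> to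
  \<open>a'\<close> avoids \<open>a\<close>.\<close>

lemma cyclic_at_rotate:
  assumes "simple_graph E" "cyclic_at E x a b"
  shows "\<exists>a'. cyclic_at E a x a'"
proof -
  let ?D = "restr E (- {x})"
  have ba: "?D\<^sup>*\<^sup>* b a" "E x a" "E x b" "a \<noteq> b"
    using cyclic_at_commute[OF assms] by (auto simp: cyclic_at_def)
  then obtain a' where a': "(restr ?D (- {a}))\<^sup>*\<^sup>* b a'" "?D a' a"
    using rtranclp_first_hit[of ?D b a a] by auto
  have "(restr E (- {a}))\<^sup>*\<^sup>* b a'"
    by (rule rtranclp_mono_le[OF _ a'(1)]) (auto simp: restr_def)
  moreover have "restr E (- {a}) x b"
    using ba assms(1) by (auto simp: restr_def simple_graph_def)
  ultimately have "(restr E (- {a}))\<^sup>*\<^sup>* x a'" by (rule converse_rtranclp_into_rtranclp[rotated])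
  moreover have "E a x" "E a a'" "x \<noteq> a'"
    using a' ba simple_graph_sym[OF assms(1)] by (auto simp: restr_def)
  ultimately show ?thesis unfolding cyclic_at_def by blast
qed

text \<open>Building the graph edge by edge, an edge between connected vertices closes a cycle at
  \<open>a\<close>; any other edge keeps \<open>theta\<close>, and a cyclic pair of the smaller
  graph persists.\<close>

lemma theta_pos_cyclic:
  fixes E :: "'n::finite \<Rightarrow> 'n \<Rightarrow> bool"
  assumes "simple_graph E" "theta E > 0"
  shows "\<exists>x a b. cyclic_at E x a b"
  using assms
proof (induction rule: simple_graph_induct)
  case empty
  then show ?case by (simp add: theta_empty)
next
  case (add E a b)
  let ?A = "add_edge E a b"
  show ?case
  proof (cases "E\<^sup>*\<^sup>* a b")
    case True
    then have "E\<^sup>*\<^sup>* b a" by (rule conn_sym[OF add.hyps(1)])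
    then obtain a' where a': "(restr E (- {a}))\<^sup>*\<^sup>* b a'" "E a' a"
      using rtranclp_first_hit[of E b a a] add.hyps(2) by auto
    have "(restr ?A (- {a}))\<^sup>*\<^sup>* b a'"
      by (rule rtranclp_mono_le[OF _ a'(1)]) (auto simp: restr_def add_edge_def)
    moreover have "?A a b" "?A a a'" "b \<noteq> a'"
      using a'(2) add.hyps simple_graph_sym[OF add.hyps(1)] by (auto simp: add_edge_def)
    ultimately show ?thesis unfolding cyclic_at_def by blast
  next
    case False
    then have "theta E > 0" using add.prems add.hyps by (simp add: theta_add_edge)
    then obtain x c d where cd: "cyclic_at E x c d" using add.IH by blast
    have "(restr ?A (- {x}))\<^sup>*\<^sup>* c d"
      by (rule rtranclp_mono_le[of "restr E (- {x})"])
        (use cd in \<open>auto simp: restr_def add_edge_def cyclic_at_def\<close>)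
    then have "cyclic_at ?A x c d" using cd by (auto simp: cyclic_at_def add_edge_def)
    then show ?thesis by blast
  qed
qed

text \<open>The handshake lemma, by adding one edge at a time.\<close>

lemma deg_sum:
  fixes E :: "'n::finite \<Rightarrow> 'n \<Rightarrow> bool"
  assumes "simple_graph E"
  shows "(\<Sum>v\<in>UNIV. deg E v) = 2 * card (edges E)"
  using assms
proof (induction rule: simple_graph_induct)
  case empty
  then show ?case by (simp add: deg_def edges_def)
next
  case (add E a b)
  have "edges (add_edge E a b) = insert {a, b} (edges E)"
    unfolding edges_def add_edge_def by auto
  moreover have "{a, b} \<notin> edges E"
    using add.hyps by (auto simp: edges_def doubleton_eq_iff dest: simple_graph_sym)
  ultimately have e: "card (edges (add_edge E a b)) = card (edges E) + 1"
    by simp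
  have "deg (add_edge E a b) v = deg E v + (if v = a then 1 else 0) + (if v = b then 1 else 0)" for v
  proof -
    have "{u. add_edge E a b v u} = (if v = a then insert b {u. E v u}
      else if v = b then insert a {u. E v u} else {u. E v u})"
      using add.hyps by (auto simp: add_edge_def doubleton_eq_iff)
    moreover have "\<not> E b a" using add.hyps by (auto dest: simple_graph_sym)
    ultimately show ?thesis using add.hyps by (simp add: deg_def)
  qed
  then show ?case using add.IH e by (simp add: sum.distrib)
qed

section \<open>Rank inequality and nullity bound\<close>

definition wmat :: "('n::finite \<Rightarrow> 'n \<Rightarrow> bool) \<Rightarrow> ('n \<Rightarrow> 'n \<Rightarrow> 'a::field) \<Rightarrow> 'a^'n^'n" where
  "wmat E w = (\<chi> i j. if E i j then w i j else 0)"

text \<open>For complex numbers of modulus one the conjugate is the inverse, so gain functions have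
  this property. It makes sense over every field and covers the constant weight 1 of the ordinary
  adjacency matrix.\<close>

definition gains :: "('n \<Rightarrow> 'n \<Rightarrow> bool) \<Rightarrow> ('n \<Rightarrow> 'n \<Rightarrow> 'a::field) \<Rightarrow> bool" where
  "gains E w \<longleftrightarrow> (\<forall>u v. E u v \<longrightarrow> w u v * w v u = 1)"

lemma gains_restr: "gains E w \<Longrightarrow> gains (restr E S) w"
  by (simp add: gains_def restr_def)

lemma gains_flip: "gains E w \<Longrightarrow> gains E (\<lambda>u v. w v u)"
  by (simp add: gains_def mult.commute)

lemma transpose_wmat: "simple_graph E \<Longrightarrow> transpose (wmat E w) = wmat E (\<lambda>u v. w v u)"
  by (auto simp: wmat_def transpose_def vec_eq_iff simple_graph_def)

lemma del_idx_wmat: "del_idx x (wmat E w) = wmat (restr E (- {x})) w"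
  by (auto simp: del_idx_def zero_row_def zero_col_def wmat_def restr_def vec_eq_iff)

lemma rank_isolate_le: "rank (wmat (restr E (- {x})) w) \<le> rank (wmat E w)"
  and rank_le_isolate: "rank (wmat E w) \<le> rank (wmat (restr E (- {x})) w) + 2"
  using rank_del_idx_le[of x "wmat E w"] rank_le_del_idx[of "wmat E w" x]
  by (simp_all add: del_idx_wmat)

lemma matrix_vector_mult_axis: "(M *v axis v c) $ i = M $ i $ v * c"
  by (simp add: matrix_vector_mult_def axis_def mult_delta_right)

lemma wmat_pendant_mult:
  assumes "simple_graph E" "gains E w" "\<And>y. E v y \<longleftrightarrow> y = u"
  shows "wmat E w *v axis v (w v u) = axis u 1"
proof -
  have "E i v \<longleftrightarrow> i = u" for i
    using assms(3) simple_graph_sym[OF assms(1), of i v] simple_graph_sym[OF assms(1), of v i] by auto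
  moreover have "w u v * w v u = 1"
    using assms by (metis gains_def mult.commute)
  ultimately show ?thesis
    unfolding vec_eq_iff matrix_vector_mult_axis by (simp add: wmat_def axis_def)
qed

text \<open>The column and the row of the pendant vertex \<open>v\<close> are multiples of the unit
  vector at \<open>u\<close>, and \<open>v\<close> differs from \<open>u\<close>. Isolating
  \<open>u\<close> isolates \<open>v\<close> too, so this is the rank effect of a
  \<delta>-transformation.\<close>

lemma rank_pendant:
  assumes "simple_graph E" "gains E w" "\<And>y. E v y \<longleftrightarrow> y = u"
  shows "rank (wmat E w) = rank (wmat (restr E (- {u})) w) + 2"
proof -
  have "v \<noteq> u" using assms(1,3) by (auto simp: simple_graph_def)
  then have "rank (wmat E w) = rank (del_idx u (wmat E w)) + 2"
    using wmat_pendant_mult[OF assms] wmat_pendant_mult[OF assms(1) gains_flip[OF assms(2)] assms(3)]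
    by (intro rank_del_idx_axis2) (auto simp: transpose_wmat[OF assms(1)] axis_def)
  then show ?thesis by (simp add: del_idx_wmat)
qed

lemma rank_wmat_le: "rank (wmat E w) \<le> card {v. deg E v \<noteq> 0}"
proof -
  have "row i (wmat E w) \<in> vec.span ((\<lambda>i. row i (wmat E w)) ` {v. deg E v \<noteq> 0})" for i
  proof (cases "deg E i = 0")
    case True
    then have "row i (wmat E w) = 0"
      by (auto simp: deg_def row_def wmat_def vec_eq_iff)
    then show ?thesis by (simp add: vec.span_zero)
  qed (auto intro: vec.span_base)
  then have "rows (wmat E w) \<subseteq> vec.span ((\<lambda>i. row i (wmat E w)) ` {v. deg E v \<noteq> 0})"
    by (auto simp: rows_def)
  then have "rank (wmat E w) \<le> card ((\<lambda>i. row i (wmat E w)) ` {v. deg E v \<noteq> 0})"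
    unfolding row_rank_def_gen by (intro vec.dim_le_card) auto
  also have "\<dots> \<le> card {v. deg E v \<noteq> 0}" by (rule card_image_le) simp
  finally show ?thesis .
qed

section \<open>Degrees, isolated and pendant vertices\<close>

lemma deg_pos: "E v u \<Longrightarrow> 0 < deg E v" for E :: "'n::finite \<Rightarrow> 'n \<Rightarrow> bool"
  by (auto simp: deg_def card_gt_0_iff)

lemma deg_ge_2: "E v a \<Longrightarrow> E v b \<Longrightarrow> a \<noteq> b \<Longrightarrow> 2 \<le> deg E v" for E :: "'n::finite \<Rightarrow> 'n \<Rightarrow> bool"
  using card_mono[of "{u. E v u}" "{a, b}"] by (simp add: deg_def)

lemma deg_2_neighbours:
  fixes E :: "'n::finite \<Rightarrow> 'n \<Rightarrow> bool"
  assumes "E v a" "E v b" "a \<noteq> b" "deg E v = 2" "E v y"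
  shows "y = a \<or> y = b"
proof -
  have "{a, b} = {u. E v u}"
    using assms by (intro card_subset_eq) (auto simp: deg_def)
  then show ?thesis using assms(5) by auto
qed

lemma deg_1_iff: "deg E v = 1 \<longleftrightarrow> (\<exists>u. \<forall>y. E v y \<longleftrightarrow> y = u)"
  by (simp add: deg_def card_1_singleton_iff set_eq_iff)

lemma component_isolated:
  fixes E :: "'n::finite \<Rightarrow> 'n \<Rightarrow> bool"
  assumes "deg E v = 0"
  shows "{w. E\<^sup>*\<^sup>* v w} = {v}"
proof -
  have "w = v" if "E\<^sup>*\<^sup>* v w" for w
    using that
  proof (cases rule: converse_rtranclpE)
    case (step y)
    then show ?thesis using deg_pos[of E v y] assms by simp
  qed simp
  then show ?thesis by auto
qed

lemma isolated_conn_classes: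
  fixes E :: "'n::finite \<Rightarrow> 'n \<Rightarrow> bool"
  shows "(\<lambda>v. {v}) ` {v. deg E v = 0} \<subseteq> conn_classes E"
    and "card ((\<lambda>v. {v}) ` {v. deg E v = 0}) = card {v. deg E v = 0}"
  using component_isolated by (auto simp: conn_classes_def image_iff card_image)

text \<open>Otherwise all non-isolated vertices have degree at least two, so by the handshake lemma
  there are at least as many edges as such vertices. The component of \<open>x\<close> comes on top
  of the isolated ones, which makes \<open>theta\<close> positive.\<close>

lemma ex_pendant:
  fixes E :: "'n::finite \<Rightarrow> 'n \<Rightarrow> bool"
  assumes "simple_graph E" "theta E = 0" "E x y"
  shows "\<exists>v. deg E v = 1"
proof (rule ccontr)
  assume no: "\<nexists>v. deg E v = 1"
  let ?I = "{v. deg E v = 0}"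
  have "2 * card (- ?I) = (\<Sum>v\<in>- ?I. 2)" by simp
  also have "\<dots> \<le> (\<Sum>v\<in>- ?I. deg E v)"
  proof (rule sum_mono)
    fix v assume "v \<in> - ?I"
    then have "deg E v \<noteq> 0" "deg E v \<noteq> 1" using no by auto
    then show "2 \<le> deg E v" by linarith
  qed
  also have "\<dots> \<le> (\<Sum>v\<in>UNIV. deg E v)" by (rule sum_mono2) auto
  finally have 1: "card (- ?I) \<le> card (edges E)" using deg_sum[OF assms(1)] by simp
  have "{w. E\<^sup>*\<^sup>* x w} \<notin> (\<lambda>v. {v}) ` ?I"
  proof
    assume "{w. E\<^sup>*\<^sup>* x w} \<in> (\<lambda>v. {v}) ` ?I"
    then obtain v where "{w. E\<^sup>*\<^sup>* x w} = {v}" "deg E v = 0" by auto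
    then have "deg E x = 0" by (metis mem_Collect_eq rtranclp.rtrancl_refl singletonD)
    then show False using deg_pos[of E x y] assms(3) by simp
  qed
  moreover have "{w. E\<^sup>*\<^sup>* x w} \<in> conn_classes E" by (auto simp: conn_classes_def)
  ultimately have "(\<lambda>v. {v}) ` ?I \<subset> conn_classes E"
    using isolated_conn_classes(1) by blast
  then have "card ?I < card (conn_classes E)"
    using psubset_card_mono[of "conn_classes E" "(\<lambda>v. {v}) ` ?I"] isolated_conn_classes(2)[of E] by simp
  moreover have "card ?I + card (- ?I) = CARD('n)"
    using card_Un_disjoint[of ?I "- ?I"] by (simp add: Compl_partition)
  ultimately show False using 1 assms(2) unfolding theta_conn_classes by simp
qed

section \<open>Forests and the rank inequality\<close>

lemma card_edges_isolate_less:
  fixes E :: "'n::finite \<Rightarrow> 'n \<Rightarrow> bool"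
  assumes "E x y"
  shows "card (edges (restr E (- {x}))) < card (edges E)"
proof -
  have "edges (restr E (- {x})) \<subseteq> edges E" by (auto simp: edges_def restr_def)
  moreover have "{x, y} \<notin> edges (restr E (- {x}))"
    by (auto simp: edges_def restr_def doubleton_eq_iff)
  moreover have "{x, y} \<in> edges E" using assms by (auto simp: edges_def)
  ultimately show ?thesis by (intro psubset_card_mono) auto
qed

lemma theta_0_isolate:
  "simple_graph E \<Longrightarrow> theta E = 0 \<Longrightarrow> theta (restr E S) = 0"
  by (metis order_antisym simple_graph_restr theta_nonneg theta_restr_le)

text \<open>Every removal of a pendant vertex with its neighbour lowers both ranks by two, until no
  edge is left and both are zero. The weights may lie in different fields.\<close>

lemma forest_rank_eq:
  fixes E :: "'n::finite \<Rightarrow> 'n \<Rightarrow> bool"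
    and w :: "'n \<Rightarrow> 'n \<Rightarrow> 'a::field" and w' :: "'n \<Rightarrow> 'n \<Rightarrow> 'b::field"
  assumes "simple_graph E" "theta E = 0" "gains E w" "gains E w'"
  shows "rank (wmat E w) = rank (wmat E w')"
  using assms
proof (induction "card (edges E)" arbitrary: E rule: less_induct)
  case less
  show ?case
  proof (cases "\<exists>x y. E x y")
    case True
    then obtain x y where "E x y" by blast
    then obtain v where "deg E v = 1" using ex_pendant[OF less.prems(1,2), of x y] by blast
    then obtain u where vu: "\<And>y. E v y \<longleftrightarrow> y = u" unfolding deg_1_iff by blast
    then have "E u v" using simple_graph_sym[OF less.prems(1), of v u] by simp
    have "rank (wmat (restr E (- {u})) w) = rank (wmat (restr E (- {u})) w')"
      using less.prems card_edges_isolate_less[of E u v, OF \<open>E u v\<close>]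
      by (intro less.hyps) (simp_all add: simple_graph_restr gains_restr theta_0_isolate)
    then show ?thesis
      using rank_pendant[OF less.prems(1) less.prems(3) vu] rank_pendant[OF less.prems(1) less.prems(4) vu]
      by simp
  next
    case False
    then have "{v. deg E v \<noteq> 0} = {}" by (auto simp: deg_def)
    then show ?thesis using rank_wmat_le[of E w] rank_wmat_le[of E w'] by simp
  qed
qed

lemma rank_le_rank_theta:
  fixes E :: "'n::finite \<Rightarrow> 'n \<Rightarrow> bool"
    and w :: "'n \<Rightarrow> 'n \<Rightarrow> 'a::field" and w' :: "'n \<Rightarrow> 'n \<Rightarrow> 'b::field"
  assumes "simple_graph E" "gains E w" "gains E w'"
  shows "int (rank (wmat E w)) \<le> int (rank (wmat E w')) + 2 * theta E"
  using assms
proof (induction "card (edges E)" arbitrary: E rule: less_induct)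
  case less
  show ?case
  proof (cases "theta E = 0")
    case True
    then show ?thesis using forest_rank_eq[OF less.prems(1) True less.prems(2,3)] by simp
  next
    case False
    then have "theta E > 0" using theta_nonneg[OF less.prems(1)] by simp
    then obtain x a b where c: "cyclic_at E x a b" using theta_pos_cyclic[OF less.prems(1)] by blast
    let ?D = "restr E (- {x})"
    have "E x a" using c by (simp add: cyclic_at_def)
    have "int (rank (wmat ?D w)) \<le> int (rank (wmat ?D w')) + 2 * theta ?D"
      using less.prems card_edges_isolate_less[of E x a, OF \<open>E x a\<close>]
      by (intro less.hyps) (simp_all add: simple_graph_restr gains_restr)
    then show ?thesis
      using theta_cyclic_drop[OF less.prems(1) c] rank_isolate_le[of E x w'] rank_le_isolate[of E w x]
      by linarith
  qed
qed

section \<open>Consequences of equality in the rank inequality\<close>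

definition tight :: "('n::finite \<Rightarrow> 'n \<Rightarrow> bool) \<Rightarrow> ('n \<Rightarrow> 'n \<Rightarrow> 'a::field) \<Rightarrow> ('n \<Rightarrow> 'n \<Rightarrow> 'b::field) \<Rightarrow> bool"
  where "tight E w w' \<longleftrightarrow> int (rank (wmat E w)) = int (rank (wmat E w')) + 2 * theta E"

text \<open>The rank inequality for the smaller graph leaves no slack: each of the three estimates
  for isolating \<open>x\<close> must be an equality.\<close>

lemma tight_cyclic:
  fixes E :: "'n::finite \<Rightarrow> 'n \<Rightarrow> bool"
  assumes "simple_graph E" "gains E w" "gains E w'" "tight E w w'" "cyclic_at E x a b"
  shows "theta E = theta (restr E (- {x})) + 1"
    and "rank (wmat E w) = rank (wmat (restr E (- {x})) w) + 2"
    and "rank (wmat E w') = rank (wmat (restr E (- {x})) w')"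
  using assms(4) theta_cyclic_drop[OF assms(1,5)] rank_isolate_le[of E x w'] rank_le_isolate[of E w x]
    rank_le_rank_theta[OF simple_graph_restr[OF assms(1)] gains_restr[OF assms(2)] gains_restr[OF assms(3)], of "- {x}"]
  unfolding tight_def by linarith+

text \<open>Both ranks fall by two, so the rank inequality for the smaller graph prevents
  \<open>theta\<close> from falling. Hence \<open>u\<close> lies on no cycle.\<close>

lemma tight_pendant:
  fixes E :: "'n::finite \<Rightarrow> 'n \<Rightarrow> bool"
  assumes "simple_graph E" "gains E w" "gains E w'" "tight E w w'" "\<And>y. E v y \<longleftrightarrow> y = u"
  shows "tight (restr E (- {u})) w w'" and "theta (restr E (- {u})) = theta E"
    and "\<not> cyclic_at E u a b"
proof -
  show t: "theta (restr E (- {u})) = theta E"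
    using assms(4) rank_pendant[OF assms(1,2,5)] rank_pendant[OF assms(1,3,5)] theta_restr_le[OF assms(1), of "- {u}"]
      rank_le_rank_theta[OF simple_graph_restr[OF assms(1)] gains_restr[OF assms(2)] gains_restr[OF assms(3)], of "- {u}"]
    unfolding tight_def by linarith
  show "tight (restr E (- {u})) w w'"
    using assms(4) rank_pendant[OF assms(1,2,5)] rank_pendant[OF assms(1,3,5)] t
    unfolding tight_def by linarith
  show "\<not> cyclic_at E u a b" using t theta_cyclic_drop[OF assms(1), of u a b] by auto
qed

section \<open>The nullity bound\<close>

definition deg_defect :: "('n::finite \<Rightarrow> 'n \<Rightarrow> bool) \<Rightarrow> int" where
  "deg_defect E = (\<Sum>v\<in>UNIV. \<bar>int (deg E v) - 2\<bar>)"

text \<open>These are the components consisting of a single cycle, as \<open>bare_cycle\<close>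
  confirms.\<close>

definition bare :: "('n \<Rightarrow> 'n \<Rightarrow> bool) \<Rightarrow> 'n set set" where
  "bare E = {K \<in> conn_classes E. \<forall>v\<in>K. deg E v = 2}"

lemma deg_isolate:
  fixes E :: "'n::finite \<Rightarrow> 'n \<Rightarrow> bool"
  assumes "simple_graph E"
  shows "deg (restr E (- {x})) v = (if v = x then 0 else if E x v then deg E v - 1 else deg E v)"
proof -
  have "{u. restr E (- {x}) v u} = (if v = x then {} else {u. E v u} - {x})"
    by (auto simp: restr_def)
  then show ?thesis
    using simple_graph_sym[OF assms, of x v] simple_graph_sym[OF assms, of v x]
    by (auto simp: deg_def card_Diff_singleton_if)
qed

text \<open>The vertex \<open>x\<close> gains at most 4 minus its degree. A neighbour of degree at
  most two gains 1, one of larger degree loses 1, so the degree of \<open>x\<close> cancels.\<close>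

lemma deg_defect_isolate:
  fixes E :: "'n::finite \<Rightarrow> 'n \<Rightarrow> bool"
  assumes "simple_graph E"
  shows "deg_defect (restr E (- {x})) \<le> deg_defect E + 4 - 2 * int (card {a. E x a \<and> 3 \<le> deg E a})"
proof -
  let ?D = "restr E (- {x})" and ?N = "{a. E x a}" and ?N3 = "{a. E x a \<and> 3 \<le> deg E a}"
  \<comment> \<open>Upper bound for the change at each vertex; the last two terms combine to 1 or -1
    at a neighbour.\<close>
  let ?g = "\<lambda>v. (if v = x then 4 - int (deg E x) else 0) + (if E x v then 1 else 0)
    - (if E x v \<and> 3 \<le> deg E v then 2 else 0)"
  have "\<bar>int (deg ?D v) - 2\<bar> \<le> \<bar>int (deg E v) - 2\<bar> + ?g v" for v
  proof (cases "E x v")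
    case True
    then have "0 < deg E v" "v \<noteq> x"
      using deg_pos[of E v x] simple_graph_sym[OF assms True] simple_graph_neq[OF assms True] by auto
    then show ?thesis using True by (auto simp: deg_isolate[OF assms] abs_if of_nat_diff)
  qed (auto simp: deg_isolate[OF assms])
  then have "deg_defect ?D \<le> (\<Sum>v\<in>UNIV. \<bar>int (deg E v) - 2\<bar> + ?g v)"
    unfolding deg_defect_def by (rule sum_mono)
  also have "\<dots> = deg_defect E + (4 - int (deg E x) + int (card ?N) - 2 * int (card ?N3))"
    unfolding deg_defect_def
    by (simp add: sum.distrib sum_subtractf sum.If_cases flip: sum_distrib_left)
  finally show ?thesis by (simp add: deg_def)
qed

lemma bare_isolate_notin:
  fixes E :: "'n::finite \<Rightarrow> 'n \<Rightarrow> bool"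
  assumes "K \<in> bare (restr E (- {x}))"
  shows "x \<notin> K"
proof
  assume "x \<in> K"
  then have "deg (restr E (- {x})) x = 2" using assms by (simp add: bare_def)
  then show False by (simp add: deg_def restr_def)
qed

text \<open>Without a neighbour of \<open>x\<close> in \<open>K\<close>, a walk in \<open>E\<close>
  that starts in \<open>K\<close> never reaches \<open>x\<close>, and no degree in \<open>K\<close>
  has changed.\<close>

lemma bare_isolate:
  fixes E :: "'n::finite \<Rightarrow> 'n \<Rightarrow> bool"
  assumes "simple_graph E" "K \<in> bare (restr E (- {x}))" "\<And>a. a \<in> K \<Longrightarrow> \<not> E x a"
  shows "K \<in> bare E"
proof -
  let ?D = "restr E (- {x})"
  have x: "x \<notin> K" by (rule bare_isolate_notin[OF assms(2)])
  from assms(2) obtain v where K: "K = {w. ?D\<^sup>*\<^sup>* v w}" by (auto simp: bare_def conn_classes_def)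
  have "?D\<^sup>*\<^sup>* v w" if "E\<^sup>*\<^sup>* v w" for w
    using that
  proof (induction rule: rtranclp_induct)
    case (step y z)
    then have "y \<in> K" by (simp add: K)
    then have "y \<noteq> x" "z \<noteq> x"
      using x assms(3) simple_graph_sym[OF assms(1) step.hyps(2)] by auto
    then have "?D y z" using step.hyps(2) by (simp add: restr_def)
    then show ?case using step.IH by (rule rtranclp.rtrancl_into_rtrancl[rotated])
  qed simp
  moreover have "E\<^sup>*\<^sup>* v w" if "?D\<^sup>*\<^sup>* v w" for w
    by (rule rtranclp_mono_le[OF _ that]) (simp add: restr_def)
  ultimately have "K \<in> conn_classes E" unfolding K conn_classes_def by blast
  moreover have "deg E u = 2" if "u \<in> K" for u
  proof -
    have "deg ?D u = 2" using assms(2) that by (simp add: bare_def)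
    then show ?thesis using that x assms(3) by (auto simp: deg_isolate[OF assms(1)] split: if_splits)
  qed
  ultimately show ?thesis by (simp add: bare_def)
qed

text \<open>A newly created cycle component contains a neighbour of \<open>x\<close> that had degree
  three. As \<open>y\<close> and \<open>z\<close> stay connected, one can always choose such a
  neighbour other than \<open>y\<close>, so fewer new components arise than there are branching
  neighbours.\<close>

lemma bare_isolate_branch:
  fixes E :: "'n::finite \<Rightarrow> 'n \<Rightarrow> bool"
  assumes "simple_graph E" "cyclic_at E x y z" "3 \<le> deg E y"
  shows "card (bare (restr E (- {x}))) + 1 \<le> card (bare E) + card {a. E x a \<and> 3 \<le> deg E a}"
proof -
  let ?D = "restr E (- {x})" and ?N3 = "{a. E x a \<and> 3 \<le> deg E a}"
  have D: "simple_graph ?D" by (rule simple_graph_restr[OF assms(1)])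
  have "bare ?D \<subseteq> bare E \<union> (\<lambda>a. {w. ?D\<^sup>*\<^sup>* a w}) ` (?N3 - {y})"
  proof
    fix K assume K: "K \<in> bare ?D"
    then have comp: "K \<in> conn_classes ?D" by (simp add: bare_def)
    have x: "x \<notin> K" by (rule bare_isolate_notin[OF K])
    have N3: "a \<in> ?N3" if "a \<in> K" "E x a" for a
    proof -
      have "deg ?D a = 2" using K that by (simp add: bare_def)
      then show ?thesis using that x by (auto simp: deg_isolate[OF assms(1)] split: if_splits)
    qed
    show "K \<in> bare E \<union> (\<lambda>a. {w. ?D\<^sup>*\<^sup>* a w}) ` (?N3 - {y})"
    proof (cases "\<exists>a\<in>K. E x a")
      case True
      have "\<exists>a\<in>K. a \<in> ?N3 - {y}"
      proof (cases "y \<in> K")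
        case True
        \<comment> \<open>The walk that avoids \<open>x\<close> keeps \<open>z\<close> in the class
          of \<open>y\<close>, so \<open>z\<close> can represent it.\<close>
        then have "z \<in> K" using component_eq[OF D comp True] assms(2) by (simp add: cyclic_at_def)
        then show ?thesis using N3[of z] assms(2) by (auto simp: cyclic_at_def)
      next
        case False
        then show ?thesis using \<open>\<exists>a\<in>K. E x a\<close> N3 by blast
      qed
      then show ?thesis using component_eq[OF D comp] by blast
    next
      case False
      then show ?thesis using bare_isolate[OF assms(1) K] by blast
    qed
  qed
  then have "card (bare ?D) \<le> card (bare E \<union> (\<lambda>a. {w. ?D\<^sup>*\<^sup>* a w}) ` (?N3 - {y}))"
    by (intro card_mono) auto
  also have "\<dots> \<le> card (bare E) + card ((\<lambda>a. {w. ?D\<^sup>*\<^sup>* a w}) ` (?N3 - {y}))"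
    by (rule card_Un_le)
  also have "\<dots> \<le> card (bare E) + card (?N3 - {y})"
    by (intro add_left_mono card_image_le) simp
  finally have "card (bare ?D) \<le> card (bare E) + card (?N3 - {y})" .
  moreover have "y \<in> ?N3" using assms by (simp add: cyclic_at_def)
  then have "card ?N3 = card (?N3 - {y}) + 1" by (subst card.remove[of _ y]) auto
  ultimately show ?thesis by simp
qed

text \<open>The cycle component of \<open>x\<close> is lost, and none is created: the former
  neighbours of \<open>x\<close> now have degree one.\<close>

lemma bare_isolate_cycle:
  fixes E :: "'n::finite \<Rightarrow> 'n \<Rightarrow> bool"
  assumes "simple_graph E" "\<And>v. E\<^sup>*\<^sup>* x v \<Longrightarrow> deg E v = 2"
  shows "card (bare (restr E (- {x}))) + 1 \<le> card (bare E)"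
proof -
  let ?K = "{v. E\<^sup>*\<^sup>* x v}"
  have "bare (restr E (- {x})) \<subseteq> bare E - {?K}"
  proof
    fix K assume K: "K \<in> bare (restr E (- {x}))"
    have x: "x \<notin> K" by (rule bare_isolate_notin[OF K])
    have "\<not> E x a" if "a \<in> K" for a
    proof
      assume "E x a"
      then have "deg E a = 2" "a \<noteq> x" using assms by (auto simp: simple_graph_def)
      moreover have "deg (restr E (- {x})) a = 2" using K that by (simp add: bare_def)
      ultimately show False using \<open>E x a\<close> by (simp add: deg_isolate[OF assms(1)])
    qed
    then have "K \<in> bare E" by (rule bare_isolate[OF assms(1) K])
    then show "K \<in> bare E - {?K}" using x by auto
  qed
  then have "card (bare (restr E (- {x}))) \<le> card (bare E - {?K})" by (intro card_mono) auto
  moreover have "?K \<in> bare E" using assms(2) by (auto simp: bare_def conn_classes_def)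
  then have "card (bare E) = card (bare E - {?K}) + 1" by (subst card.remove[of _ ?K]) auto
  ultimately show ?thesis by simp
qed

text \<open>By rotation, a vertex with a cyclic pair belongs to a cyclic pair at its neighbour,
  hence has degree exactly two. Its neighbours are then the pair itself, and they have cyclic pairs
  again, so the property spreads over the component.\<close>

lemma cyclic_component_degree_2:
  fixes E :: "'n::finite \<Rightarrow> 'n \<Rightarrow> bool"
  assumes "simple_graph E" and no: "\<And>x a b. cyclic_at E x a b \<Longrightarrow> deg E a < 3"
    and "cyclic_at E x a b" "E\<^sup>*\<^sup>* x v"
  shows "deg E v = 2"
proof -
  have deg2: "deg E v = 2" if c: "cyclic_at E v a b" for v a b
  proof -
    obtain a' where "cyclic_at E a v a'" using cyclic_at_rotate[OF assms(1) c] by blast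
    then have "deg E v < 3" by (rule no)
    moreover have "2 \<le> deg E v" by (rule deg_ge_2[of E v a b]) (use c in \<open>auto simp: cyclic_at_def\<close>)
    ultimately show ?thesis by simp
  qed
  from assms(4) have "\<exists>a b. cyclic_at E v a b"
  proof (induction rule: rtranclp_induct)
    case base
    then show ?case using assms(3) by blast
  next
    case (step y z)
    then obtain a b where ab: "cyclic_at E y a b" by blast
    then have "z = a \<or> z = b"
      using deg_2_neighbours[of E y a b z] deg2[OF ab] step.hyps(2) by (auto simp: cyclic_at_def)
    then show ?case
      using ab cyclic_at_commute[OF assms(1) ab] cyclic_at_rotate[OF assms(1)] by blast
  qed
  then show ?thesis using deg2 by blast
qed

text \<open>Isolating the neighbour of a pendant vertex raises the nullity by two and
  \<open>deg_defect\<close> by at most four, so the bound passes back. Without edges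
  \<open>deg_defect\<close> is twice the number of vertices.\<close>

lemma forest_nullity_le:
  fixes E :: "'n::finite \<Rightarrow> 'n \<Rightarrow> bool" and w :: "'n \<Rightarrow> 'n \<Rightarrow> 'a::field"
  assumes "simple_graph E" "theta E = 0" "gains E w"
  shows "2 * (int (CARD('n)) - int (rank (wmat E w))) \<le> deg_defect E"
  using assms
proof (induction "card (edges E)" arbitrary: E rule: less_induct)
  case less
  show ?case
  proof (cases "\<exists>x y. E x y")
    case True
    then obtain x y where "E x y" by blast
    then obtain v where "deg E v = 1" using ex_pendant[OF less.prems(1,2), of x y] by blast
    then obtain u where vu: "\<And>y. E v y \<longleftrightarrow> y = u" unfolding deg_1_iff by blast
    then have "E u v" using simple_graph_sym[OF less.prems(1), of v u] by simp
    let ?D = "restr E (- {u})"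
    have "2 * (int (CARD('n)) - int (rank (wmat ?D w))) \<le> deg_defect ?D"
      using less.prems card_edges_isolate_less[of E u v, OF \<open>E u v\<close>]
      by (intro less.hyps) (simp_all add: simple_graph_restr gains_restr theta_0_isolate)
    moreover have "int (rank (wmat E w)) = int (rank (wmat ?D w)) + 2"
      using rank_pendant[OF less.prems(1) less.prems(3) vu] by simp
    ultimately show ?thesis
      using deg_defect_isolate[OF less.prems(1), of u]
      by (simp add: algebra_simps)
  next
    case False
    then have "deg E v = 0" for v by (auto simp: deg_def)
    then show ?thesis by (simp add: deg_defect_def)
  qed
qed

text \<open>Isolating a cycle vertex does not lower the nullity. On the right,
  \<open>deg_defect\<close> grows by at most 4 minus twice the number of branching neighbours, and
  the drops in \<open>theta\<close> and \<open>bare\<close> pay for this.\<close>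

lemma nullity_le:
  fixes E :: "'n::finite \<Rightarrow> 'n \<Rightarrow> bool" and w :: "'n \<Rightarrow> 'n \<Rightarrow> 'a::field"
  assumes "simple_graph E" "gains E w"
  shows "2 * (int (CARD('n)) - int (rank (wmat E w))) \<le> deg_defect E + 2 * theta E + 2 * int (card (bare E))"
  using assms
proof (induction "card (edges E)" arbitrary: E rule: less_induct)
  case less
  note simple = less.prems(1)
  have step: ?case if c: "cyclic_at E x a b"
    and le: "card (bare (restr E (- {x}))) + 1 \<le> card (bare E) + card {a. E x a \<and> 3 \<le> deg E a}" for x a b
  proof -
    let ?D = "restr E (- {x})"
    have "E x a" using c by (simp add: cyclic_at_def)
    have "2 * (int (CARD('n)) - int (rank (wmat ?D w)))
        \<le> deg_defect ?D + 2 * theta ?D + 2 * int (card (bare ?D))"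
      using less.prems card_edges_isolate_less[of E x a, OF \<open>E x a\<close>]
      by (intro less.hyps) (simp_all add: simple_graph_restr gains_restr)
    moreover have "int (rank (wmat ?D w)) \<le> int (rank (wmat E w))"
      using rank_isolate_le[of E x w] by simp
    moreover have "int (card (bare ?D)) + 1 \<le> int (card (bare E)) + int (card {a. E x a \<and> 3 \<le> deg E a})"
      using le by linarith
    ultimately show ?thesis
      using deg_defect_isolate[OF simple, of x] theta_cyclic_drop[OF simple c]
      by (simp add: algebra_simps)
  qed
  show ?case
  proof (cases "theta E = 0")
    case True
    then show ?thesis using forest_nullity_le[OF simple True less.prems(2)] by simp
  next
    case False
    then have "theta E > 0" using theta_nonneg[OF simple] by simp
    then obtain x a b where c: "cyclic_at E x a b" using theta_pos_cyclic[OF simple] by blast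
    show ?thesis
    \<comment> \<open>If possible, \<open>x\<close> is taken next to a branching vertex of its
      cycle; otherwise every component with a cycle is a single cycle.\<close>
    proof (cases "\<exists>x y z. cyclic_at E x y z \<and> 3 \<le> deg E y")
      case True
      then show ?thesis using step bare_isolate_branch[OF simple] by blast
    next
      case False
      then have "card (bare (restr E (- {x}))) + 1 \<le> card (bare E)"
        by (intro bare_isolate_cycle[OF simple] cyclic_component_degree_2[OF simple _ c])
          (auto simp: not_le)
      then show ?thesis using step[OF c] by linarith
    qed
  qed
qed

text \<open>Isolated vertices bound the rank for \<open>w\<close>, so tightness makes the nullity
  for \<open>w'\<close> large, while \<open>nullity_le\<close> bounds it above. Together they leave
  room for no component other than isolated vertices and single cycles.\<close>

lemma deg_0_or_2:
  fixes E :: "'n::finite \<Rightarrow> 'n \<Rightarrow> bool"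
  assumes "simple_graph E" "gains E w" "gains E w'" "tight E w w'" and no: "\<And>v. deg E v \<noteq> 1"
  shows "deg E v = 0 \<or> deg E v = 2" and "theta E = int (card (bare E))"
proof -
  let ?I = "{v. deg E v = 0}"
  let ?C = "(\<lambda>v. {v}) ` ?I"
  have defect: "deg_defect E = 2 * int (card (edges E)) - 2 * int (CARD('n)) + 4 * int (card ?I)"
  proof -
    \<comment> \<open>As degree one is excluded, only degree 0 needs a correction: 2 instead of
      -2.\<close>
    have "\<bar>int (deg E v) - 2\<bar> = int (deg E v) - 2 + (if deg E v = 0 then 4 else 0)" for v
      using no[of v] by (cases "deg E v = 0") auto
    then have "deg_defect E = (\<Sum>v\<in>UNIV. int (deg E v)) - 2 * int (CARD('n)) + 4 * int (card ?I)"
      unfolding deg_defect_def by (simp add: sum.distrib sum_subtractf sum.If_cases)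
    moreover have "(\<Sum>v\<in>UNIV. int (deg E v)) = 2 * int (card (edges E))"
      using deg_sum[OF assms(1)] by (metis of_nat_mult of_nat_numeral of_nat_sum)
    ultimately show ?thesis by simp
  qed
  have "card ?I + card (- ?I) = CARD('n)"
    using card_Un_disjoint[of ?I "- ?I"] by (simp add: Compl_partition)
  moreover have "- ?I = {v. deg E v \<noteq> 0}" by auto
  ultimately have "card ?I + card {v. deg E v \<noteq> 0} = CARD('n)" by metis
  then have "int (rank (wmat E w)) + int (card ?I) \<le> int (CARD('n))"
    using rank_wmat_le[of E w] by linarith
  then have le: "card (conn_classes E) \<le> card ?I + card (bare E)"
    using nullity_le[OF assms(1,3)] assms(4) defect
    unfolding tight_def theta_conn_classes by (simp add: algebra_simps)
  have sub: "?C \<union> bare E \<subseteq> conn_classes E"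
    using isolated_conn_classes(1)[of E] by (auto simp: bare_def)
  have "?C \<inter> bare E = {}" by (auto simp: bare_def)
  then have "card (?C \<union> bare E) = card ?I + card (bare E)"
    using isolated_conn_classes(2)[of E] by (simp add: card_Un_disjoint)
  then have card_eq: "card (conn_classes E) = card ?I + card (bare E)"
    and card_eq': "card (?C \<union> bare E) = card (conn_classes E)"
    using card_mono[OF _ sub] le by auto
  have eq: "?C \<union> bare E = conn_classes E"
    by (rule card_subset_eq[OF _ sub card_eq']) simp
  show deg: "deg E v = 0 \<or> deg E v = 2" for v
  proof -
    have v: "v \<in> {w. E\<^sup>*\<^sup>* v w}" by simp
    have "{w. E\<^sup>*\<^sup>* v w} \<in> ?C \<union> bare E" unfolding eq conn_classes_def by blast
    then show ?thesis
    proof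
      assume "{w. E\<^sup>*\<^sup>* v w} \<in> ?C"
      then obtain u where "deg E u = 0" "{w. E\<^sup>*\<^sup>* v w} = {u}" by auto
      then show ?thesis using v by (metis singletonD)
    next
      assume "{w. E\<^sup>*\<^sup>* v w} \<in> bare E"
      then show ?thesis using v unfolding bare_def by blast
    qed
  qed
  \<comment> \<open>With the degrees known, \<open>deg_defect\<close> is computed a second time;
    comparing both values yields edges minus vertices, and thus \<open>theta\<close>.\<close>
  have "\<bar>int (deg E v) - 2\<bar> = (if deg E v = 0 then 2 else 0)" for v
    using deg[of v] by auto
  then have "deg_defect E = 2 * int (card ?I)"
    unfolding deg_defect_def by (simp add: sum.If_cases)
  then show "theta E = int (card (bare E))"
    using defect card_eq unfolding theta_conn_classes by simp
qed

section \<open>Cycles\<close>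

text \<open>Indices run over all naturals, so that walking round the cycle needs no case split at
  the end of the list.\<close>

definition cyc :: "'n list \<Rightarrow> nat \<Rightarrow> 'n" where
  "cyc c i = c ! (i mod length c)"

lemma cyc_eq_iff:
  assumes "is_cycle E c"
  shows "cyc c i = cyc c j \<longleftrightarrow> i mod length c = j mod length c"
proof -
  have "i mod length c < length c" "j mod length c < length c"
    using assms by (auto simp: is_cycle_def intro!: mod_less_divisor)
  then show ?thesis using assms by (simp add: cyc_def is_cycle_def nth_eq_iff_index_eq)
qed

lemma cyc_add_eq_iff:
  assumes "is_cycle E c"
  shows "cyc c (i + k) = cyc c i \<longleftrightarrow> length c dvd k"
  unfolding cyc_eq_iff[OF assms] by (simp add: mod_eq_dvd_iff_nat)

lemma cyc_add_length [simp]: "cyc c (i + length c) = cyc c i"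
  by (simp add: cyc_def)

lemma cyc_adj:
  assumes "is_cycle E c"
  shows "E (cyc c i) (cyc c (Suc i))"
proof -
  have "i mod length c < length c"
    using assms by (auto simp: is_cycle_def intro!: mod_less_divisor)
  then have "E (c ! (i mod length c)) (c ! ((i mod length c + 1) mod length c))"
    using assms unfolding is_cycle_def by blast
  then show ?thesis by (simp add: cyc_def mod_Suc_eq)
qed

lemma cyc_neq:
  assumes "is_cycle E c"
  shows "cyc c i \<noteq> cyc c (Suc (Suc i))"
proof
  assume "cyc c i = cyc c (Suc (Suc i))"
  then have "length c dvd 2" using cyc_add_eq_iff[OF assms, of i 2] by simp
  then show False using assms by (auto simp: is_cycle_def dest: dvd_imp_le)
qed

lemma range_cyc:
  assumes "is_cycle E c"
  shows "range (cyc c) = set c"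
proof -
  have "length c > 0" using assms by (auto simp: is_cycle_def)
  then have "cyc c i \<in> set c" for i by (simp add: cyc_def)
  moreover have "x \<in> range (cyc c)" if x: "x \<in> set c" for x
  proof -
    obtain i where "i < length c" "x = c ! i" using x by (auto simp: in_set_conv_nth)
    then have "x = cyc c i" by (simp add: cyc_def)
    then show ?thesis by blast
  qed
  ultimately show ?thesis by blast
qed

text \<open>A successor index gives access to both cycle neighbours without subtraction.\<close>

lemma in_set_cyc_Suc:
  assumes "is_cycle E c" "x \<in> set c"
  obtains i where "x = cyc c (Suc i)"
proof -
  obtain j where j: "x = cyc c j" using assms range_cyc by blast
  have "length c \<noteq> 0" using assms by (auto simp: is_cycle_def)
  then have "Suc (j + (length c - 1)) = j + length c" by simp
  then have "x = cyc c (Suc (j + (length c - 1)))"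
    using j cyc_add_length[of c j] by (simp only:)
  then show ?thesis using that by blast
qed

lemma cycle_edges_cyc:
  assumes "is_cycle E c"
  shows "cycle_edges c = range (\<lambda>i. {cyc c i, cyc c (Suc i)})"
proof -
  have l: "length c > 0" using assms by (auto simp: is_cycle_def)
  have 1: "{c ! i, c ! ((i + 1) mod length c)} = {cyc c i, cyc c (Suc i)}" if "i < length c" for i
    using that by (simp add: cyc_def)
  have 2: "{cyc c i, cyc c (Suc i)} =
    {c ! (i mod length c), c ! ((i mod length c + 1) mod length c)}" for i
    by (simp add: cyc_def mod_Suc_eq)
  show ?thesis
  proof
    show "cycle_edges c \<subseteq> range (\<lambda>i. {cyc c i, cyc c (Suc i)})"
      unfolding cycle_edges_def using 1 by blast
    show "range (\<lambda>i. {cyc c i, cyc c (Suc i)}) \<subseteq> cycle_edges c"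
      unfolding cycle_edges_def 2 using mod_less_divisor[OF l] by blast
  qed
qed

lemma cycle_edges_at:
  assumes "is_cycle E c"
  shows "{cyc c (Suc i), y} \<in> cycle_edges c \<longleftrightarrow> y = cyc c i \<or> y = cyc c (Suc (Suc i))"
proof
  assume "{cyc c (Suc i), y} \<in> cycle_edges c"
  then obtain j where "{cyc c (Suc i), y} = {cyc c j, cyc c (Suc j)}"
    unfolding cycle_edges_cyc[OF assms] by blast
  then consider "cyc c (Suc i) = cyc c j" "y = cyc c (Suc j)"
    | "cyc c (Suc i) = cyc c (Suc j)" "y = cyc c j"
    by (auto simp: doubleton_eq_iff)
  then show "y = cyc c i \<or> y = cyc c (Suc (Suc i))"
  proof cases
    case 1
    then have "Suc (Suc i) mod length c = Suc j mod length c"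
      unfolding cyc_eq_iff[OF assms] by (metis mod_Suc_eq)
    then show ?thesis using 1 cyc_eq_iff[OF assms] by simp
  next
    case 2
    have l: "length c \<noteq> 0" using assms by (auto simp: is_cycle_def)
    \<comment> \<open>Adding \<open>length c - 1\<close> undoes the successor modulo the
      length.\<close>
    have "(Suc i + (length c - 1)) mod length c = (Suc j + (length c - 1)) mod length c"
      using 2(1) unfolding cyc_eq_iff[OF assms] by (metis mod_add_left_eq)
    then have "i mod length c = j mod length c" using l by simp
    then show ?thesis using 2 cyc_eq_iff[OF assms] by simp
  qed
next
  assume "y = cyc c i \<or> y = cyc c (Suc (Suc i))"
  then show "{cyc c (Suc i), y} \<in> cycle_edges c"
    unfolding cycle_edges_cyc[OF assms] by (auto simp: insert_commute)
qed

lemma cycle_edges_subset_set: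
  assumes "is_cycle E c" "e \<in> cycle_edges c"
  shows "e \<subseteq> set c"
  using assms(2) range_cyc[OF assms(1)] unfolding cycle_edges_cyc[OF assms(1)] by blast

text \<open>Going forward from the successor of the chosen vertex to its predecessor passes offsets
  strictly between 0 and the length, so the vertex itself is avoided.\<close>

lemma cycle_cyclic_at:
  assumes "is_cycle E c" "simple_graph E"
  shows "cyclic_at E (cyc c (Suc i)) (cyc c i) (cyc c (Suc (Suc i)))"
proof -
  let ?x = "cyc c (Suc i)"
  let ?D = "restr E (- {?x})"
  have l: "length c \<ge> 3" using assms by (simp add: is_cycle_def)
  have neq: "cyc c (Suc i + k) \<noteq> ?x" if "0 < k" "k < length c" for k
    using that cyc_add_eq_iff[OF assms(1), of "Suc i" k] by (auto dest: dvd_imp_le)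
  have "?D\<^sup>*\<^sup>* (cyc c (Suc i + 1)) (cyc c (Suc i + Suc k))" if "Suc k < length c" for k
    using that
  proof (induction k)
    case (Suc k)
    have "?D (cyc c (Suc i + Suc k)) (cyc c (Suc i + Suc (Suc k)))"
      using neq[of "Suc k"] neq[of "Suc (Suc k)"] cyc_adj[OF assms(1), of "Suc i + Suc k"] Suc.prems
      by (simp add: restr_def)
    then show ?case using Suc by (meson Suc_lessD rtranclp.rtrancl_into_rtrancl)
  qed simp
  note reach = this[of "length c - 2"]
  have "?D\<^sup>*\<^sup>* (cyc c (Suc (Suc i))) (cyc c (i + length c))"
  proof -
    have "Suc i + Suc (length c - 2) = i + length c" "Suc (length c - 2) < length c" using l by auto
    then show ?thesis using reach by simp
  qed
  then have "?D\<^sup>*\<^sup>* (cyc c i) (cyc c (Suc (Suc i)))"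
    using conn_sym[OF simple_graph_restr[OF assms(2)]] by simp
  then show ?thesis
    using cyc_adj[OF assms(1)] cyc_neq[OF assms(1)] simple_graph_sym[OF assms(2)]
    unfolding cyclic_at_def by blast
qed

text \<open>By \<open>pair\<close>, two cycles meeting at a vertex have the same two neighbours
  there. The next edge of \<open>c1\<close> therefore lies on \<open>c2\<close> and leads to another
  common vertex, and so on round \<open>c1\<close>.\<close>

lemma cycle_edges_subset:
  assumes "simple_graph E" "is_cycle E c1" "is_cycle E c2" "set c1 \<inter> set c2 \<noteq> {}"
    and pair: "\<And>x a b c d. cyclic_at E x a b \<Longrightarrow> cyclic_at E x c d \<Longrightarrow> {a, b} = {c, d}"
  shows "cycle_edges c1 \<subseteq> cycle_edges c2"
proof -
  obtain x where "x \<in> set c1" "x \<in> set c2" using assms(4) by blast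
  then obtain i where i: "cyc c1 i \<in> set c2"
    using range_cyc[OF assms(2)] by (metis imageE)
  have step: "{cyc c1 j, cyc c1 (Suc j)} \<in> cycle_edges c2" if j: "cyc c1 j \<in> set c2" for j
  proof -
    have l: "length c1 \<noteq> 0" using assms(2) by (auto simp: is_cycle_def)
    define m where "m = j + (length c1 - 1)"
    have "Suc m = j + length c1" "Suc (Suc m) = Suc j + length c1" using l by (simp_all add: m_def)
    then have m: "cyc c1 (Suc m) = cyc c1 j" "cyc c1 (Suc (Suc m)) = cyc c1 (Suc j)"
      by (simp_all only: cyc_add_length)
    obtain n where n: "cyc c1 j = cyc c2 (Suc n)" using in_set_cyc_Suc[OF assms(3) j] by blast
    have "{cyc c1 m, cyc c1 (Suc (Suc m))} = {cyc c2 n, cyc c2 (Suc (Suc n))}"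
      using cycle_cyclic_at[OF assms(2,1), of m] cycle_cyclic_at[OF assms(3,1), of n] m n
      by (intro pair[of "cyc c1 j"]) simp_all
    then have "cyc c1 (Suc j) = cyc c2 n \<or> cyc c1 (Suc j) = cyc c2 (Suc (Suc n))"
      unfolding m by blast
    then show ?thesis unfolding n cycle_edges_at[OF assms(3)] .
  qed
  have mem: "cyc c1 (i + k) \<in> set c2" for k
  proof (induction k)
    case (Suc k)
    then show ?case using cycle_edges_subset_set[OF assms(3) step] by simp
  qed (use i in simp)
  have "cyc c1 j \<in> set c2" for j
  proof -
    \<comment> \<open>This offset moves from position \<open>i\<close> forward to one congruent to
      \<open>j\<close>, so every position is reached.\<close>
    have "i + (j + i * (length c1 - 1)) = j + i * length c1"
      using assms(2) by (cases "length c1") (auto simp: is_cycle_def)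
    moreover have "cyc c1 (j + i * length c1) = cyc c1 j" by (simp add: cyc_def)
    ultimately have "cyc c1 (i + (j + i * (length c1 - 1))) = cyc c1 j" by (simp only:)
    then show ?thesis using mem by metis
  qed
  then show ?thesis using step unfolding cycle_edges_cyc[OF assms(2)] by blast
qed

section \<open>Alternating vectors on a cycle\<close>

text \<open>The gains are taken against the direction of travel, so the full product is the inverse
  of the cycle gain.\<close>

definition cyc_prod :: "('n \<Rightarrow> 'n \<Rightarrow> 'a::field) \<Rightarrow> 'n list \<Rightarrow> nat \<Rightarrow> 'a" where
  "cyc_prod w c i = (\<Prod>j<i. w (cyc c (Suc j)) (cyc c j))"

lemma cyc_prod_add_length: "cyc_prod w c (i + length c) = cyc_prod w c i * cyc_prod w c (length c)"
proof (induction i)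
  case (Suc i)
  have "cyc c (Suc (i + length c)) = cyc c (Suc i)"
    using cyc_add_length[of c "Suc i"] by simp
  then show ?case using Suc by (simp add: cyc_prod_def)
qed (simp add: cyc_prod_def)

text \<open>A cycle without chords that is a whole component.\<close>

definition closed_cycle :: "('n \<Rightarrow> 'n \<Rightarrow> bool) \<Rightarrow> 'n list \<Rightarrow> bool" where
  "closed_cycle E c \<longleftrightarrow> is_cycle E c \<and> (\<forall>v u. v \<in> set c \<longrightarrow> E v u \<longrightarrow> {v, u} \<in> cycle_edges c)"

text \<open>After rescaling the coordinates along the cycle by partial products of the gains, the
  matrix acts on the cycle as that of an ungained path; the gain appears only when
  the coordinates wrap around.\<close>

lemma wmat_cycle_mult:
  fixes E :: "'n::finite \<Rightarrow> 'n \<Rightarrow> bool"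
  assumes "simple_graph E" "gains E w" "closed_cycle E c"
  shows "wmat E w *v axis (cyc c (Suc i)) (cyc_prod w c (Suc i)) =
    axis (cyc c i) (cyc_prod w c i) + axis (cyc c (Suc (Suc i))) (cyc_prod w c (Suc (Suc i)))"
proof -
  let ?x = "cyc c (Suc i)" and ?a = "cyc c i" and ?b = "cyc c (Suc (Suc i))"
  have c: "is_cycle E c" using assms(3) by (simp add: closed_cycle_def)
  have x: "?x \<in> set c" using range_cyc[OF c] by blast
  have E: "E r ?x \<longleftrightarrow> r = ?a \<or> r = ?b" for r
  proof
    assume "E r ?x"
    then have "E ?x r" by (rule simple_graph_sym[OF assms(1)])
    then have "{?x, r} \<in> cycle_edges c" using assms(3) x by (simp add: closed_cycle_def)
    then show "r = ?a \<or> r = ?b" by (simp add: cycle_edges_at[OF c])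
  next
    assume "r = ?a \<or> r = ?b"
    then show "E r ?x"
      using cyc_adj[OF c, of i] cyc_adj[OF c, of "Suc i"] simple_graph_sym[OF assms(1), of ?x ?b] by auto
  qed
  have ab: "?a \<noteq> ?b" by (rule cyc_neq[OF c])
  have "E ?x ?a" using cyc_adj[OF c, of i] by (rule simple_graph_sym[OF assms(1)])
  then have "w ?x ?a * w ?a ?x = 1" using assms(2) by (simp add: gains_def)
  then have 1: "w ?a ?x * cyc_prod w c (Suc i) = cyc_prod w c i"
    by (simp add: cyc_prod_def) (metis mult.commute mult.left_commute mult_1_right)
  have 2: "w ?b ?x * cyc_prod w c (Suc i) = cyc_prod w c (Suc (Suc i))"
    by (simp add: cyc_prod_def)
  have "(wmat E w *v axis ?x (cyc_prod w c (Suc i))) $ r =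
      (axis ?a (cyc_prod w c i) + axis ?b (cyc_prod w c (Suc (Suc i)))) $ r" for r
    unfolding matrix_vector_mult_axis using ab by (auto simp: wmat_def E axis_def 1 2)
  then show ?thesis by (simp add: vec_eq_iff)
qed

definition cyc_vec :: "('n::finite \<Rightarrow> 'n \<Rightarrow> 'a::field) \<Rightarrow> 'n list \<Rightarrow> nat \<Rightarrow> 'a^'n" where
  "cyc_vec w c i = axis (cyc c i) (cyc_prod w c i)"

definition alt_vec :: "('n::finite \<Rightarrow> 'n \<Rightarrow> 'a::field) \<Rightarrow> 'n list \<Rightarrow> nat \<Rightarrow> nat \<Rightarrow> 'a^'n" where
  "alt_vec w c s m = (\<Sum>k<m. (- 1) ^ k *s cyc_vec w c (Suc (s + 2 * k)))"

text \<open>The sum telescopes: consecutive terms share a vector with opposite signs, and only the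
  two ends remain.\<close>

lemma wmat_alt_vec:
  assumes "simple_graph E" "gains E w" "closed_cycle E c"
  shows "wmat E w *v alt_vec w c s m = cyc_vec w c s - (- 1) ^ m *s cyc_vec w c (s + 2 * m)"
proof (induction m)
  case 0
  show ?case by (simp add: alt_vec_def)
next
  case (Suc m)
  have "wmat E w *v alt_vec w c s (Suc m) = wmat E w *v alt_vec w c s m
      + (- 1) ^ m *s (wmat E w *v cyc_vec w c (Suc (s + 2 * m)))"
    by (simp add: alt_vec_def matrix_vector_right_distrib vec.scale)
  also have "wmat E w *v cyc_vec w c (Suc (s + 2 * m)) =
      cyc_vec w c (s + 2 * m) + cyc_vec w c (s + 2 * Suc m)"
    using wmat_cycle_mult[OF assms, of "s + 2 * m"] by (simp add: cyc_vec_def)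
  finally show ?case by (simp add: Suc vec_eq_iff algebra_simps)
qed

lemma cyc_vec_add_length:
  "cyc_vec w c (i + length c) = cyc_prod w c (length c) *s cyc_vec w c i"
  by (simp add: cyc_vec_def cyc_prod_add_length vec_eq_iff axis_def)

lemma cyc_vec_0: "cyc_vec w c 0 = axis (c ! 0) 1"
  by (simp add: cyc_vec_def cyc_def cyc_prod_def)

text \<open>After half the length many terms the two ends coincide, and the image is
  \<open>d\<close> times the unit vector at \<open>c ! 0\<close>; the assumption on the gain makes
  \<open>d\<close> nonzero. The vector lives on odd positions, hence vanishes at
  \<open>c ! 0\<close>.\<close>

lemma cycle_axis_even:
  fixes w :: "'n::finite \<Rightarrow> 'n \<Rightarrow> 'a::field"
  assumes "simple_graph E" "gains E w" "closed_cycle E c" "length c = 2 * m"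
    and g: "cyc_prod w c (length c) \<noteq> (- 1) ^ m"
  shows "\<exists>u. wmat E w *v u = axis (c ! 0) 1 \<and> u $ (c ! 0) = 0"
proof -
  define d where "d = 1 - (- 1) ^ m * cyc_prod w c (length c)"
  have sq: "(- 1) ^ m * (- 1) ^ m = (1 :: 'a)" by (simp flip: power_mult_distrib)
  have "d \<noteq> 0"
  proof
    assume "d = 0"
    then have "(- 1) ^ m * ((- 1) ^ m * cyc_prod w c (length c)) = (- 1) ^ m" by (simp add: d_def)
    then show False using g sq by (simp flip: mult.assoc)
  qed
  have "wmat E w *v alt_vec w c 0 m = cyc_vec w c 0 - (- 1) ^ m *s cyc_vec w c (0 + length c)"
    using wmat_alt_vec[OF assms(1-3), of 0 m] assms(4) by simp
  also have "\<dots> = d *s axis (c ! 0) 1"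
    unfolding cyc_vec_add_length cyc_vec_0 by (simp add: d_def vec_eq_iff axis_def)
  finally have "wmat E w *v (inverse d *s alt_vec w c 0 m) = axis (c ! 0) 1"
    using \<open>d \<noteq> 0\<close> by (simp add: vec.scale)
  moreover have "alt_vec w c 0 m $ (c ! 0) = 0"
  proof -
    have c: "is_cycle E c" using assms(3) by (simp add: closed_cycle_def)
    have ne: "cyc c (Suc (2 * k)) \<noteq> c ! 0" if "k < m" for k
      using cyc_eq_iff[OF c, of "Suc (2 * k)" 0] that assms(4) by (simp add: cyc_def)
    have "cyc_vec w c (Suc (0 + 2 * k)) $ (c ! 0) = 0" if "k < m" for k
      using ne[OF that, symmetric] by (simp add: cyc_vec_def axis_def)
    then show ?thesis by (simp add: alt_vec_def)
  qed
  ultimately show ?thesis by (intro exI[of _ "inverse d *s alt_vec w c 0 m"]) simp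
qed

text \<open>The same sum started at position 1: now the two ends cancel, and the vector lives on the
  even positions.\<close>

lemma cycle_kernel_even:
  fixes w :: "'n::finite \<Rightarrow> 'n \<Rightarrow> 'a::field"
  assumes "simple_graph E" "gains E w" "closed_cycle E c" "length c = 2 * m"
    and g: "cyc_prod w c (length c) = (- 1) ^ m"
  shows "\<exists>u. wmat E w *v u = 0 \<and> u $ (c ! 0) \<noteq> 0"
proof -
  have sq: "(- 1) ^ m * (- 1) ^ m = (1 :: 'a)" by (simp flip: power_mult_distrib)
  have c: "is_cycle E c" using assms(3) by (simp add: closed_cycle_def)
  have "wmat E w *v alt_vec w c 1 m = cyc_vec w c 1 - (- 1) ^ m *s cyc_vec w c (1 + length c)"
    using wmat_alt_vec[OF assms(1-3), of 1 m] assms(4) by simp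
  also have "\<dots> = 0"
    unfolding cyc_vec_add_length g by (simp add: sq)
  finally have "wmat E w *v alt_vec w c 1 m = 0" .
  moreover have "alt_vec w c 1 m $ (c ! 0) \<noteq> 0"
  proof -
    have "m > 0" using c assms(4) by (auto simp: is_cycle_def)
    then obtain n where n: "m = Suc n" by (cases m) auto
    have ne: "cyc c (Suc (1 + 2 * k)) \<noteq> c ! 0" if "k < n" for k
      using cyc_eq_iff[OF c, of "Suc (1 + 2 * k)" 0] that assms(4) n by (simp add: cyc_def)
    have "cyc_vec w c (Suc (1 + 2 * k)) $ (c ! 0) = 0" if "k < n" for k
      using ne[OF that, symmetric] by (simp add: cyc_vec_def axis_def)
    then have "(\<Sum>k<n. (- 1) ^ k *s cyc_vec w c (Suc (1 + 2 * k))) $ (c ! 0) = 0"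
      by simp
    \<comment> \<open>Only the last term sits at \<open>c ! 0\<close>, after one full turn, so its
      coefficient there cannot cancel.\<close>
    moreover have "Suc (1 + 2 * n) = length c" using assms(4) n by simp
    moreover have "cyc_vec w c (length c) $ (c ! 0) = (- 1) ^ m"
      using g cyc_vec_add_length[of w c 0] by (simp add: cyc_vec_0 axis_def)
    ultimately show ?thesis unfolding n alt_vec_def by simp
  qed
  ultimately show ?thesis by blast
qed

text \<open>On an odd cycle steps of two return to the start after two turns. The gain then enters
  squared, and the odd number of terms turns the minus sign into a plus.\<close>

lemma cycle_axis_odd:
  fixes w :: "'n::finite \<Rightarrow> 'n \<Rightarrow> 'a::field"
  assumes "simple_graph E" "gains E w" "closed_cycle E c" "odd (length c)"
    and g: "1 + cyc_prod w c (length c) ^ 2 \<noteq> 0"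
  shows "\<exists>u. wmat E w *v u = axis (c ! 0) 1"
proof -
  let ?g = "cyc_prod w c (length c)"
  have "cyc_vec w c (2 * length c) = ?g *s (?g *s cyc_vec w c 0)"
    using cyc_vec_add_length[of w c "length c"] cyc_vec_add_length[of w c 0] by (simp add: mult_2)
  moreover define d where "d = 1 + ?g ^ 2"
  ultimately have "wmat E w *v alt_vec w c 0 (length c) = d *s axis (c ! 0) 1"
    using wmat_alt_vec[OF assms(1-3), of 0 "length c"] assms(4)
    by (simp add: cyc_vec_0 vec_eq_iff axis_def power2_eq_square)
  moreover have "d \<noteq> 0" using g by (simp add: d_def)
  ultimately have "wmat E w *v (inverse d *s alt_vec w c 0 (length c)) = axis (c ! 0) 1"
    by (simp add: vec.scale)
  then show ?thesis by blast
qed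

section \<open>Rank change when a cycle component is opened\<close>

definition gain_prod :: "('n \<Rightarrow> 'n \<Rightarrow> 'a::field) \<Rightarrow> 'n list \<Rightarrow> 'a" where
  "gain_prod w c = (\<Prod>i<length c. w (c ! i) (c ! ((i + 1) mod length c)))"

lemma gain_prod_cyc: "gain_prod w c = cyc_prod (\<lambda>u v. w v u) c (length c)"
  by (simp add: gain_prod_def cyc_prod_def cyc_def)

lemma gain_prod_inverse:
  assumes "gains E w" "is_cycle E c"
  shows "gain_prod w c * cyc_prod w c (length c) = 1"
  unfolding gain_prod_cyc cyc_prod_def prod.distrib[symmetric]
  using assms(1) cyc_adj[OF assms(2)] by (intro prod.neutral) (auto simp: gains_def)

lemma sign_eq_iff:
  fixes a b :: "'a::field"
  assumes "a * b = 1"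
  shows "a = (- 1) ^ m \<longleftrightarrow> b = (- 1) ^ m"
proof -
  have "(- 1) ^ m * (- 1) ^ m = (1 :: 'a)" by (simp flip: power_mult_distrib)
  then show ?thesis using assms
    by (metis mult.commute mult.left_commute mult_1_right)
qed

text \<open>Signs are their own inverses, so the gain and its inverse both differ from the critical
  sign. This gives unit-vector preimages for the matrix and for its transpose, which carries the
  reversed gains.\<close>

lemma rank_type_B_cycle:
  fixes w :: "'n::finite \<Rightarrow> 'n \<Rightarrow> 'a::field"
  assumes "simple_graph E" "gains E w" "closed_cycle E c" "length c = 2 * m"
    and g: "gain_prod w c \<noteq> (- 1) ^ m"
  shows "rank (wmat E w) = rank (wmat (restr E (- {c ! 0})) w) + 2"
proof -
  have c: "is_cycle E c" using assms(3) by (simp add: closed_cycle_def)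
  have "cyc_prod w c (length c) \<noteq> (- 1) ^ m"
    using g sign_eq_iff[OF gain_prod_inverse[OF assms(2) c]] by blast
  then obtain v where v: "wmat E w *v v = axis (c ! 0) 1" "v $ (c ! 0) = 0"
    using cycle_axis_even[OF assms(1-4)] by blast
  obtain u where "wmat E (\<lambda>u v. w v u) *v u = axis (c ! 0) 1"
    using cycle_axis_even[OF assms(1) gains_flip[OF assms(2)] assms(3,4)] g
    unfolding gain_prod_cyc by blast
  then show ?thesis
    using rank_del_idx_axis2[of "wmat E w" u "c ! 0" v] v
    by (simp add: transpose_wmat[OF assms(1)] del_idx_wmat)
qed

lemma rank_type_A_cycle:
  fixes w :: "'n::finite \<Rightarrow> 'n \<Rightarrow> 'a::field"
  assumes "simple_graph E" "gains E w" "closed_cycle E c" "length c = 2 * m"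
    and g: "gain_prod w c = (- 1) ^ m"
  shows "rank (wmat (restr E (- {c ! 0})) w) = rank (wmat E w)"
proof -
  have c: "is_cycle E c" using assms(3) by (simp add: closed_cycle_def)
  have "cyc_prod w c (length c) = (- 1) ^ m"
    using g sign_eq_iff[OF gain_prod_inverse[OF assms(2) c]] by blast
  then obtain v where v: "wmat E w *v v = 0" "v $ (c ! 0) \<noteq> 0"
    using cycle_kernel_even[OF assms(1-4)] by blast
  obtain u where "wmat E (\<lambda>u v. w v u) *v u = 0" "u $ (c ! 0) \<noteq> 0"
    using cycle_kernel_even[OF assms(1) gains_flip[OF assms(2)] assms(3,4)] g
    unfolding gain_prod_cyc by blast
  then show ?thesis
    using rank_del_idx_kernel[of "wmat E w" u "c ! 0" v] v
    by (simp add: transpose_wmat[OF assms(1)] del_idx_wmat)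
qed

text \<open>Here the factor from two turns is 2, nonzero over the reals. A strict drop is enough to
  exclude odd cycles, since tightness keeps this rank fixed.\<close>

lemma rank_odd_cycle:
  assumes "simple_graph E" "closed_cycle E c" "odd (length c)"
  shows "rank (wmat (restr E (- {c ! 0})) (\<lambda>_ _. 1 :: real)) < rank (wmat E (\<lambda>_ _. 1 :: real))"
proof -
  have "gains E (\<lambda>_ _. 1 :: real)" by (simp add: gains_def)
  moreover have "1 + cyc_prod (\<lambda>_ _. 1 :: real) c (length c) ^ 2 \<noteq> 0"
    by (simp add: cyc_prod_def)
  ultimately obtain u where "wmat E (\<lambda>_ _. 1 :: real) *v u = axis (c ! 0) 1"
    using cycle_axis_odd[OF assms(1) _ assms(2,3)] by blast
  then show ?thesis
    using rank_del_idx_axis[of "wmat E (\<lambda>_ _. 1 :: real)" u "c ! 0"]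
    by (simp add: transpose_wmat[OF assms(1)] del_idx_wmat)
qed

section \<open>Components of degree two are cycles\<close>

lemma cycle_closed_if_deg_2:
  fixes E :: "'n::finite \<Rightarrow> 'n \<Rightarrow> bool"
  assumes "simple_graph E" "is_cycle E c" "\<And>v. v \<in> set c \<Longrightarrow> deg E v = 2"
  shows "closed_cycle E c"
  unfolding closed_cycle_def
proof (intro conjI allI impI)
  fix v u assume v: "v \<in> set c" and u: "E v u"
  obtain i where i: "v = cyc c (Suc i)" using in_set_cyc_Suc[OF assms(2) v] by blast
  have "u = cyc c i \<or> u = cyc c (Suc (Suc i))"
    using cycle_cyclic_at[OF assms(2,1), of i] assms(3)[OF v] u
    unfolding i cyclic_at_def by (intro deg_2_neighbours[of E "cyc c (Suc i)"]) auto
  then show "{v, u} \<in> cycle_edges c" unfolding i cycle_edges_at[OF assms(2)] .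
qed (rule assms(2))

text \<open>On a longest path in \<open>K\<close> all neighbours of the first vertex lie on the
  path. The one that is not the second vertex closes a cycle, and a closed cycle exhausts its
  component.\<close>

lemma bare_cycle:
  fixes E :: "'n::finite \<Rightarrow> 'n \<Rightarrow> bool"
  assumes "simple_graph E" "K \<in> bare E"
  shows "\<exists>c. is_cycle E c \<and> set c = K"
proof -
  obtain v where K: "K = {w. E\<^sup>*\<^sup>* v w}" and deg: "\<And>u. u \<in> K \<Longrightarrow> deg E u = 2"
    using assms(2) unfolding bare_def conn_classes_def by blast
  have closed: "y \<in> K" if "x \<in> K" "E x y" for x y
    using that rtranclp.rtrancl_into_rtrancl[of E v x y] by (simp add: K)
  define path where "path xs \<longleftrightarrow> xs \<noteq> [] \<and> distinct xs \<and> set xs \<subseteq> K \<and>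
    (\<forall>i. Suc i < length xs \<longrightarrow> E (xs ! i) (xs ! Suc i))" for xs
  have "path [v]" by (simp add: path_def K)
  moreover have "length xs \<le> CARD('n)" if "path xs" for xs
    using that card_mono[of UNIV "set xs"] by (simp add: path_def distinct_card)
  ultimately have "\<exists>xs. path xs \<and> (\<forall>ys. path ys \<longrightarrow> length ys \<le> length xs)"
    by (intro ex_has_greatest_nat[of path "[v]" length "Suc (CARD('n))"]) (auto simp: less_Suc_eq_le)
  then obtain xs where xs: "path xs" and max: "\<And>ys. path ys \<Longrightarrow> length ys \<le> length xs" by blast
  have ne: "xs \<noteq> []" and dist: "distinct xs" and sub: "set xs \<subseteq> K"
    and adj: "\<And>i. Suc i < length xs \<Longrightarrow> E (xs ! i) (xs ! Suc i)"
    using xs by (auto simp: path_def)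
  let ?h = "xs ! 0"
  have h: "?h \<in> K" using ne sub by auto
  have nbr: "y \<in> set xs" if y: "E ?h y" for y
  proof (rule ccontr)
    assume "y \<notin> set xs"
    moreover have "E ((y # xs) ! i) ((y # xs) ! Suc i)" if "Suc i < length (y # xs)" for i
      using that adj simple_graph_sym[OF assms(1) y] by (cases i) auto
    ultimately have "path (y # xs)"
      using dist sub closed[OF h y] by (simp add: path_def)
    then show False using max[of "y # xs"] by simp
  qed
  have "card {y. E ?h y} = 2" using deg[OF h] by (simp add: deg_def)
  then obtain a b where "{y. E ?h y} = {a, b}" "a \<noteq> b" by (auto simp: card_2_iff)
  then have "E ?h a" "E ?h b" "a \<noteq> xs ! 1 \<or> b \<noteq> xs ! 1" by auto
  then obtain y where y: "E ?h y" "y \<noteq> xs ! 1" by blast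
  obtain j where j: "j < length xs" "y = xs ! j" using nbr[OF y(1)] by (auto simp: in_set_conv_nth)
  have "j \<noteq> 0" using y j assms(1) by (metis simple_graph_irrefl)
  moreover have "j \<noteq> 1" using y j by auto
  ultimately have j2: "j \<ge> 2" by simp
  \<comment> \<open>The initial segment ending at \<open>y\<close>; \<open>j \<ge> 2\<close> ensures
    at least three vertices.\<close>
  define c where "c = take (Suc j) xs"
  have len: "length c = Suc j" using j by (simp add: c_def)
  have cyc: "is_cycle E c"
    unfolding is_cycle_def
  proof (intro conjI allI impI)
    show "3 \<le> length c" "distinct c" using len j2 dist by (simp_all add: c_def)
    fix i assume i: "i < length c"
    show "E (c ! i) (c ! ((i + 1) mod length c))"
    proof (cases "i = j")
      case True
      then show ?thesis
        using len j y(1) simple_graph_sym[OF assms(1)] by (simp add: c_def)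
    next
      case False
      then have "Suc i < length c" using i len by simp
      then show ?thesis using adj[of i] j len by (simp add: c_def)
    qed
  qed
  have csub: "set c \<subseteq> K" using sub set_take_subset[of "Suc j" xs] by (auto simp: c_def)
  have cc: "closed_cycle E c"
    by (rule cycle_closed_if_deg_2[OF assms(1) cyc]) (use csub deg in auto)
  have "K \<subseteq> set c"
  proof
    fix w assume "w \<in> K"
    obtain z where z: "z \<in> set c" using len by (cases c) auto
    then have "K = {w. E\<^sup>*\<^sup>* z w}"
      using component_eq[OF assms(1), of K z] csub assms(2) by (auto simp: bare_def)
    then have "E\<^sup>*\<^sup>* z w" using \<open>w \<in> K\<close> by simp
    then show "w \<in> set c"
    proof (induction rule: rtranclp_induct)
      case (step p q)
      then have "{p, q} \<in> cycle_edges c" using cc by (simp add: closed_cycle_def)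
      then show ?case using cycle_edges_subset_set[OF cyc] by blast
    qed (rule z)
  qed
  then show ?thesis using cyc csub by blast
qed

section \<open>Delta-transformations and the equivalence\<close>

lemma gain_adj_wmat: "gain_adj E \<phi> = wmat E \<phi>"
  by (simp add: gain_adj_def wmat_def)

lemma adj_wmat: "adj E = wmat E (\<lambda>_ _. 1)"
  by (simp add: adj_def wmat_def)

lemma gains_gain_function:
  assumes "gain_function E \<phi>"
  shows "gains E \<phi>"
  unfolding gains_def
proof (intro allI impI)
  fix u v assume "E u v"
  then have "cmod (\<phi> u v) = 1" "\<phi> v u = cnj (\<phi> u v)"
    using assms by (auto simp: gain_function_def)
  then show "\<phi> u v * \<phi> v u = 1" using complex_norm_square[of "\<phi> u v"] by simp
qed

lemma gains_one: "gains E (\<lambda>_ _. 1)"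
  by (simp add: gains_def)

section \<open>Delta-transformations as vertex isolation\<close>

lemma is_cycle_restr: "is_cycle (restr E S) c \<longleftrightarrow> is_cycle E c \<and> set c \<subseteq> S"
proof
  assume c: "is_cycle (restr E S) c"
  then have "is_cycle E c" by (auto simp: is_cycle_def restr_def)
  moreover have "set c \<subseteq> S"
    using cyc_adj[OF c] unfolding range_cyc[OF c, symmetric] by (auto simp: restr_def)
  ultimately show "is_cycle E c \<and> set c \<subseteq> S" by blast
next
  assume c: "is_cycle E c \<and> set c \<subseteq> S"
  have "c ! i \<in> S" if "i < length c" for i using c that by auto
  moreover have "(i + 1) mod length c < length c" if "i < length c" for i
    using that by (intro mod_less_divisor) auto
  ultimately show "is_cycle (restr E S) c"
    using c unfolding is_cycle_def restr_def by blast
qed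

lemma deg_in_eq_deg: "v \<in> S \<Longrightarrow> deg_in E S v = deg (restr E S) v"
  by (auto simp: deg_in_def deg_def restr_def intro!: arg_cong[of _ _ card])

lemma pendant_in_iff: "pendant_in E S v \<longleftrightarrow> deg (restr E S) v = 1"
proof (cases "v \<in> S")
  case False
  then have "deg (restr E S) v = 0" by (simp add: deg_def restr_def)
  then show ?thesis using False by (simp add: pendant_in_def)
qed (simp add: pendant_in_def deg_in_eq_deg)

text \<open>Isolating the neighbour already removes the only edge at the pendant vertex, so deleting
  both gives the same edges.\<close>

lemma delta_step_restr:
  assumes "simple_graph E" "delta_step E S S'"
  obtains v u where "\<And>y. restr E S v y \<longleftrightarrow> y = u" "restr E S' = restr (restr E S) (- {u})"
proof -
  obtain v u where vu: "pendant_in E S v" "u \<in> S" "E v u" "S' = S - {v, u}"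
    using assms(2) by (auto simp: delta_step_def)
  have "v \<in> S" using vu by (simp add: pendant_in_def)
  obtain u' where u': "\<And>y. restr E S v y \<longleftrightarrow> y = u'"
    using vu(1) unfolding pendant_in_iff deg_1_iff by blast
  have "restr E S v u" using vu \<open>v \<in> S\<close> by (simp add: restr_def)
  then have 1: "\<And>y. restr E S v y \<longleftrightarrow> y = u" using u' by simp
  have "restr E S' a b \<longleftrightarrow> restr (restr E S) (- {u}) a b" for a b
    using 1[of b] 1[of a] simple_graph_sym[OF assms(1), of a b] vu(4) by (auto simp: restr_def)
  then have "restr E S' = restr (restr E S) (- {u})" by (simp add: fun_eq_iff)
  with 1 show ?thesis by (rule that)
qed

text \<open>Every step lowers both ranks by two, so their difference is invariant; the additive form
  avoids subtraction of naturals.\<close>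

lemma delta_steps_rank:
  fixes w :: "'n::finite \<Rightarrow> 'n \<Rightarrow> 'a::field" and w' :: "'n \<Rightarrow> 'n \<Rightarrow> 'b::field"
  assumes "simple_graph E" "gains E w" "gains E w'" "(delta_step E)\<^sup>*\<^sup>* UNIV S"
  shows "rank (wmat E w) + rank (wmat (restr E S) w') = rank (wmat E w') + rank (wmat (restr E S) w)"
  using assms(4)
proof (induction rule: rtranclp_induct)
  case base
  show ?case by simp
next
  case (step S T)
  obtain v u where vu: "\<And>y. restr E S v y \<longleftrightarrow> y = u" and T: "restr E T = restr (restr E S) (- {u})"
    using delta_step_restr[OF assms(1) step.hyps(2)] by blast
  note s = simple_graph_restr[OF assms(1), of S]
  show ?case
    using step.IH rank_pendant[OF s gains_restr[OF assms(2)] vu] rank_pendant[OF s gains_restr[OF assms(3)] vu]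
    unfolding T by linarith
qed

text \<open>Steps are applied greedily while a pendant vertex exists. By
  \<open>tight_pendant\<close> each keeps tightness and \<open>theta\<close>, and the isolated
  neighbour lies on no cycle, so all cycles survive.\<close>

lemma tight_delta_steps:
  fixes w :: "'n::finite \<Rightarrow> 'n \<Rightarrow> 'a::field" and w' :: "'n \<Rightarrow> 'n \<Rightarrow> 'b::field"
  assumes "simple_graph E" "gains E w" "gains E w'" "tight (restr E S) w w'"
  shows "\<exists>S0. (delta_step E)\<^sup>*\<^sup>* S S0 \<and> (\<forall>v. \<not> pendant_in E S0 v) \<and> tight (restr E S0) w w' \<and>
    theta (restr E S0) = theta (restr E S) \<and>
    (\<forall>c. is_cycle (restr E S) c \<longrightarrow> is_cycle (restr E S0) c)"
  using assms(4)
proof (induction "card S" arbitrary: S rule: less_induct)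
  case less
  show ?case
  proof (cases "\<exists>v. pendant_in E S v")
    case True
    then obtain v where v: "pendant_in E S v" by blast
    then obtain u where u: "restr E S v u"
      unfolding pendant_in_iff deg_1_iff by blast
    define T where "T = S - {v, u}"
    have step: "delta_step E S T"
      using v u unfolding delta_step_def T_def restr_def by blast
    have "card T < card S"
      using u unfolding T_def restr_def by (intro psubset_card_mono) auto
    obtain v' u' where vu: "\<And>y. restr E S v' y \<longleftrightarrow> y = u'" and T: "restr E T = restr (restr E S) (- {u'})"
      using delta_step_restr[OF assms(1) step] by blast
    note s = simple_graph_restr[OF assms(1), of S]
    note tp = tight_pendant[OF s gains_restr[OF assms(2)] gains_restr[OF assms(3)] less.prems vu]
    obtain S0 where S0: "(delta_step E)\<^sup>*\<^sup>* T S0" "\<forall>v. \<not> pendant_in E S0 v" "tight (restr E S0) w w'"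
      "theta (restr E S0) = theta (restr E T)" "\<forall>c. is_cycle (restr E T) c \<longrightarrow> is_cycle (restr E S0) c"
      using less.hyps[OF \<open>card T < card S\<close>] tp(1) unfolding T by blast
    have "is_cycle (restr E T) c" if c: "is_cycle (restr E S) c" for c
    proof -
      have "u' \<notin> set c"
      proof
        assume "u' \<in> set c"
        then obtain i where "u' = cyc c (Suc i)" using in_set_cyc_Suc[OF c] by blast
        then show False using cycle_cyclic_at[OF c s, of i] tp(3) by blast
      qed
      then show ?thesis unfolding T is_cycle_restr[of "restr E S"] using c by blast
    qed
    then show ?thesis
      using S0 tp(2) converse_rtranclp_into_rtranclp[of "delta_step E", OF step] unfolding T by metis
  next
    case False
    then show ?thesis using less.prems by blast
  qed
qed

section \<open>The two directions of the equivalence\<close>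

text \<open>Isolating \<open>c ! 0\<close> must keep the real rank and lower the gain rank by two.
  The first excludes odd length and length 2 modulo 4, where weight 1 is of type B; the second
  excludes a gain of type A.\<close>

lemma tight_cycle_types:
  fixes E :: "'n::finite \<Rightarrow> 'n \<Rightarrow> bool" and \<phi> :: "'n \<Rightarrow> 'n \<Rightarrow> complex"
  assumes "simple_graph E" "gains E \<phi>" "tight E \<phi> (\<lambda>_ _. 1 :: real)" "closed_cycle E c"
  shows "type_B \<phi> c \<and> length c mod 4 = 0"
proof -
  have c: "is_cycle E c" using assms(4) by (simp add: closed_cycle_def)
  let ?x = "c ! 0"
  have "?x \<in> set c" using c by (intro nth_mem) (auto simp: is_cycle_def)
  then obtain i where i: "?x = cyc c (Suc i)" using in_set_cyc_Suc[OF c] by blast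
  note t = tight_cyclic[OF assms(1,2) gains_one assms(3) cycle_cyclic_at[OF c assms(1), of i], folded i]
  have "even (length c)" using rank_odd_cycle[OF assms(1,4)] t(3) by auto
  then obtain m where m: "length c = 2 * m" by blast
  have "even m"
  proof (rule ccontr)
    assume "odd m"
    then have "gain_prod (\<lambda>_ _. 1 :: real) c \<noteq> (- 1) ^ m" by (simp add: gain_prod_def)
    from rank_type_B_cycle[OF assms(1) gains_one assms(4) m this] show False using t(3) by simp
  qed
  then have "length c mod 4 = 0" using m by auto
  moreover have "gain_prod \<phi> c \<noteq> (- 1) ^ m"
    using rank_type_A_cycle[OF assms(1,2,4) m] t(2) by auto
  ultimately show ?thesis using m by (simp add: type_B_def cycle_gain_def gain_prod_def)
qed

lemma cycles_plus_isolated_if_deg: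
  fixes E :: "'n::finite \<Rightarrow> 'n \<Rightarrow> bool"
  assumes "simple_graph E" and deg: "\<And>v. deg (restr E S) v = 0 \<or> deg (restr E S) v = 2"
  shows "cycles_plus_isolated E S (card (bare (restr E S)))"
proof -
  let ?D = "restr E S"
  have D: "simple_graph ?D" by (rule simple_graph_restr[OF assms(1)])
  have "\<exists>f. \<forall>K\<in>bare ?D. is_cycle ?D (f K) \<and> set (f K) = K"
    using bare_cycle[OF D] by (intro bchoice) blast
  then obtain f where f: "\<And>K. K \<in> bare ?D \<Longrightarrow> is_cycle ?D (f K) \<and> set (f K) = K" by blast
  obtain Ks where Ks: "set Ks = bare ?D" "distinct Ks"
    using finite_distinct_list[of "bare ?D"] by auto
  define cs where "cs = map f Ks"
  have cl: "closed_cycle ?D (f K)" if "K \<in> bare ?D" for K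
    using f[OF that] that by (intro cycle_closed_if_deg_2[OF D]) (simp_all add: bare_def)
  have "length cs = card (bare ?D)" using Ks by (metis cs_def length_map distinct_card)
  moreover have "is_cycle E c \<and> set c \<subseteq> S" if c: "c \<in> set cs" for c
  proof -
    obtain K where "K \<in> bare ?D" "c = f K" using c Ks(1) by (auto simp: cs_def)
    then show ?thesis using f is_cycle_restr[of E S c] by simp
  qed
  moreover have "set (cs ! i) \<inter> set (cs ! j) = {}"
    if ij: "i < length cs" "j < length cs" "i \<noteq> j" for i j
  proof -
    have K: "Ks ! i \<in> bare ?D" "Ks ! j \<in> bare ?D" "Ks ! i \<noteq> Ks ! j"
      using ij Ks by (auto simp: cs_def nth_eq_iff_index_eq)
    have "Ks ! i \<inter> Ks ! j = {}"
    proof (rule ccontr)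
      assume "Ks ! i \<inter> Ks ! j \<noteq> {}"
      then obtain z where "z \<in> Ks ! i" "z \<in> Ks ! j" by blast
      then have "Ks ! i = {w. ?D\<^sup>*\<^sup>* z w}" "Ks ! j = {w. ?D\<^sup>*\<^sup>* z w}"
        using K(1,2) component_eq[OF D, of "Ks ! i" z] component_eq[OF D, of "Ks ! j" z]
        by (simp_all add: bare_def)
      then show False using K(3) by simp
    qed
    then show ?thesis using f K ij by (simp add: cs_def)
  qed
  moreover have "{{u, v} | u v. E u v \<and> u \<in> S \<and> v \<in> S} = (\<Union>c\<in>set cs. cycle_edges c)"
  proof
    show "{{u, v} | u v. E u v \<and> u \<in> S \<and> v \<in> S} \<subseteq> (\<Union>c\<in>set cs. cycle_edges c)"
    proof
      fix e assume "e \<in> {{u, v} | u v. E u v \<and> u \<in> S \<and> v \<in> S}"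
      then obtain u v where uv: "e = {u, v}" "?D u v" unfolding restr_def by blast
      let ?K = "{w. ?D\<^sup>*\<^sup>* u w}"
      have "deg ?D w = 2" if "?D\<^sup>*\<^sup>* u w" for w
      proof -
        \<comment> \<open>A vertex of degree 0 is alone in its component, but \<open>u\<close> has
          an edge.\<close>
        have "deg ?D w \<noteq> 0"
        proof
          assume w: "deg ?D w = 0"
          have "?D\<^sup>*\<^sup>* w u" by (rule conn_sym[OF D that])
          then have "u = w" using component_isolated[OF w] by blast
          then show False using deg_pos[of ?D u v] uv w by simp
        qed
        then show ?thesis using deg[of w] by simp
      qed
      then have K: "?K \<in> bare ?D" unfolding bare_def conn_classes_def by blast
      have "u \<in> set (f ?K)" using f[OF K] by simp
      then have "e \<in> cycle_edges (f ?K)" using cl[OF K] uv by (simp add: closed_cycle_def)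
      then show "e \<in> (\<Union>c\<in>set cs. cycle_edges c)" using K Ks(1) by (auto simp: cs_def)
    qed
    show "(\<Union>c\<in>set cs. cycle_edges c) \<subseteq> {{u, v} | u v. E u v \<and> u \<in> S \<and> v \<in> S}"
    proof
      fix e assume "e \<in> (\<Union>c\<in>set cs. cycle_edges c)"
      then obtain K where K: "K \<in> bare ?D" "e \<in> cycle_edges (f K)" using Ks(1) by (auto simp: cs_def)
      have c: "is_cycle ?D (f K)" using f K by blast
      obtain i where "e = {cyc (f K) i, cyc (f K) (Suc i)}"
        using K(2) unfolding cycle_edges_cyc[OF c] by blast
      then show "e \<in> {{u, v} | u v. E u v \<and> u \<in> S \<and> v \<in> S}"
        using cyc_adj[OF c, of i] unfolding restr_def by blast
    qed
  qed
  ultimately show ?thesis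
    unfolding cycles_plus_isolated_def by (intro exI[of _ cs]) simp
qed

text \<open>The cycles are opened one by one at their first vertices: the rank for \<open>w\<close>
  drops by two, that for \<open>w'\<close> stays, and \<open>theta\<close> drops by at least one. By
  the bound on \<open>theta\<close> a forest remains, where both ranks agree.\<close>

lemma rank_ge_disjoint_cycles:
  fixes E :: "'n::finite \<Rightarrow> 'n \<Rightarrow> bool"
    and w :: "'n \<Rightarrow> 'n \<Rightarrow> 'a::field" and w' :: "'n \<Rightarrow> 'n \<Rightarrow> 'b::field"
  assumes "simple_graph E" "gains E w" "gains E w'" "theta E \<le> int (length cs)"
    and "\<And>c. c \<in> set cs \<Longrightarrow> closed_cycle E c \<and> (\<exists>m. length c = 2 * m \<and>
      gain_prod w c \<noteq> (- 1) ^ m \<and> gain_prod w' c = (- 1) ^ m)"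
    and "\<And>i j. i < length cs \<Longrightarrow> j < length cs \<Longrightarrow> i \<noteq> j \<Longrightarrow> set (cs ! i) \<inter> set (cs ! j) = {}"
  shows "rank (wmat E w') + 2 * length cs \<le> rank (wmat E w)"
  using assms
proof (induction cs arbitrary: E)
  case Nil
  then have "theta E = 0" using theta_nonneg[of E] by simp
  then show ?case using forest_rank_eq[of E w w'] Nil by simp
next
  case (Cons c cs)
  let ?x = "c ! 0"
  let ?D = "restr E (- {?x})"
  note s = Cons.prems(1)
  obtain m where m: "closed_cycle E c" "length c = 2 * m"
      "gain_prod w c \<noteq> (- 1) ^ m" "gain_prod w' c = (- 1) ^ m"
    using Cons.prems(5)[of c] by auto
  have c: "is_cycle E c" using m(1) by (simp add: closed_cycle_def)
  have x: "?x \<in> set c" using c by (intro nth_mem) (auto simp: is_cycle_def)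
  then obtain i where i: "?x = cyc c (Suc i)" using in_set_cyc_Suc[OF c] by blast
  have "rank (wmat ?D w') + 2 * length cs \<le> rank (wmat ?D w)"
  proof (rule Cons.IH)
    show "simple_graph ?D" "gains ?D w" "gains ?D w'"
      using Cons.prems by (simp_all add: simple_graph_restr gains_restr)
    show "theta ?D \<le> int (length cs)"
      using theta_cyclic_drop[OF s cycle_cyclic_at[OF c s, of i]] Cons.prems(4) unfolding i by simp
    show "set (cs ! i) \<inter> set (cs ! j) = {}" if "i < length cs" "j < length cs" "i \<noteq> j" for i j
      using Cons.prems(6)[of "Suc i" "Suc j"] that by simp
    fix c' assume c': "c' \<in> set cs"
    then obtain j where "j < length cs" "c' = cs ! j" by (auto simp: in_set_conv_nth)
    then have "set c \<inter> set c' = {}" using Cons.prems(6)[of 0 "Suc j"] by simp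
    \<comment> \<open>Disjointness keeps the other cycles intact when \<open>?x\<close> is
      isolated.\<close>
    then have "set c' \<subseteq> - {?x}" using x by blast
    moreover have cc': "closed_cycle E c'" using Cons.prems(5)[of c'] c' by simp
    ultimately have "is_cycle ?D c'" by (simp add: is_cycle_restr closed_cycle_def)
    then have "closed_cycle ?D c'" using cc' by (simp add: closed_cycle_def restr_def)
    then show "closed_cycle ?D c' \<and> (\<exists>m. length c' = 2 * m \<and>
      gain_prod w c' \<noteq> (- 1) ^ m \<and> gain_prod w' c' = (- 1) ^ m)"
      using Cons.prems(5)[of c'] c' by simp
  qed
  then show ?case
    using rank_type_B_cycle[OF s Cons.prems(2) m(1-3)] rank_type_A_cycle[OF s Cons.prems(3) m(1,2,4)]
    by simp
qed

lemma tight_imp_conditions: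
  fixes E :: "'n::finite \<Rightarrow> 'n \<Rightarrow> bool" and \<phi> :: "'n \<Rightarrow> 'n \<Rightarrow> complex"
  assumes "simple_graph E" "gains E \<phi>" "tight E \<phi> (\<lambda>_ _. 1 :: real)"
  shows "(\<forall>c1 c2. is_cycle E c1 \<and> is_cycle E c2 \<and> cycle_edges c1 \<noteq> cycle_edges c2
         \<longrightarrow> set c1 \<inter> set c2 = {}) \<and>
     (\<forall>c. is_cycle E c \<longrightarrow> type_B \<phi> c \<and> length c mod 4 = 0) \<and>
     (\<exists>S0. crucial_subgraph E S0 \<and> cycles_plus_isolated E S0 (nat (theta E)))"
proof -
  \<comment> \<open>Two different cyclic pairs at \<open>x\<close> would make \<open>theta\<close>
    drop by two, against the exact drop of one under tightness.\<close>
  have pair: "{a, b} = {c, d}" if ab: "cyclic_at E x a b" and cd: "cyclic_at E x c d" for x a b c d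
  proof (rule ccontr)
    assume "{a, b} \<noteq> {c, d}"
    then have "theta (restr E (- {x})) + 2 \<le> theta E"
      by (rule theta_two_cyclic_drop[OF assms(1) ab cd])
    then show False using tight_cyclic(1)[OF assms(1,2) gains_one assms(3) ab] by simp
  qed
  have disjoint: "set c1 \<inter> set c2 = {}"
    if "is_cycle E c1" "is_cycle E c2" "cycle_edges c1 \<noteq> cycle_edges c2" for c1 c2
  proof (rule ccontr)
    assume ne: "set c1 \<inter> set c2 \<noteq> {}"
    then have "cycle_edges c1 \<subseteq> cycle_edges c2"
      by (rule cycle_edges_subset[OF assms(1) that(1,2) _ pair])
    moreover have "cycle_edges c2 \<subseteq> cycle_edges c1"
      by (rule cycle_edges_subset[OF assms(1) that(2,1) _ pair]) (use ne in auto)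
    ultimately show False using that(3) by simp
  qed
  obtain S0 where S0: "(delta_step E)\<^sup>*\<^sup>* UNIV S0" "\<And>v. \<not> pendant_in E S0 v"
      "tight (restr E S0) \<phi> (\<lambda>_ _. 1 :: real)" "theta (restr E S0) = theta E"
      "\<And>c. is_cycle E c \<Longrightarrow> is_cycle (restr E S0) c"
    using tight_delta_steps[OF assms(1,2) gains_one, of UNIV] assms(3) by auto
  note s = simple_graph_restr[OF assms(1), of S0]
  have no: "deg (restr E S0) v \<noteq> 1" for v
    using S0(2)[of v] by (simp add: pendant_in_iff)
  note deg = deg_0_or_2[OF s gains_restr[OF assms(2)] gains_one S0(3) no]
  have "type_B \<phi> c \<and> length c mod 4 = 0" if "is_cycle E c" for c
  proof -
    have c: "is_cycle (restr E S0) c" by (rule S0(5)[OF that])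
    \<comment> \<open>A cycle vertex has an edge, which leaves only degree two; so all cycles are
      closed in the reduced graph.\<close>
    have "deg (restr E S0) v = 2" if v: "v \<in> set c" for v
    proof -
      obtain i where i: "v = cyc c (Suc i)" using in_set_cyc_Suc[OF c v] by blast
      have "restr E S0 v (cyc c (Suc (Suc i)))" unfolding i by (rule cyc_adj[OF c])
      then show ?thesis using deg(1)[of v] deg_pos[of "restr E S0" v] by fastforce
    qed
    then have "closed_cycle (restr E S0) c" by (rule cycle_closed_if_deg_2[OF s c])
    then show ?thesis by (rule tight_cycle_types[OF s gains_restr[OF assms(2)] S0(3)])
  qed
  moreover have "crucial_subgraph E S0" using S0(1,2) by (simp add: crucial_subgraph_def)
  moreover have "cycles_plus_isolated E S0 (nat (theta E))"
    using cycles_plus_isolated_if_deg[OF assms(1) deg(1)] deg(2) S0(4) by simp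
  ultimately show ?thesis using disjoint by blast
qed

text \<open>The listed cycles force a rank gap of at least \<open>2 * theta E\<close> in the reduced
  graph. The \<delta>-transformations preserve the gap, and the rank inequality bounds it above by
  the same number.\<close>

lemma conditions_imp_tight:
  fixes E :: "'n::finite \<Rightarrow> 'n \<Rightarrow> bool" and \<phi> :: "'n \<Rightarrow> 'n \<Rightarrow> complex"
  assumes "simple_graph E" "gains E \<phi>"
    and types: "\<And>c. is_cycle E c \<Longrightarrow> type_B \<phi> c \<and> length c mod 4 = 0"
    and "(delta_step E)\<^sup>*\<^sup>* UNIV S" "cycles_plus_isolated E S (nat (theta E))"
  shows "tight E \<phi> (\<lambda>_ _. 1 :: real)"
proof -
  let ?D = "restr E S" and ?one = "\<lambda>_ _. 1 :: real"
  obtain cs where cs: "length cs = nat (theta E)"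
      "\<And>c. c \<in> set cs \<Longrightarrow> is_cycle E c \<and> set c \<subseteq> S"
      "\<And>i j. i < length cs \<Longrightarrow> j < length cs \<Longrightarrow> i \<noteq> j \<Longrightarrow> set (cs ! i) \<inter> set (cs ! j) = {}"
      "{{u, v} | u v. E u v \<and> u \<in> S \<and> v \<in> S} = (\<Union>c\<in>set cs. cycle_edges c)"
    using assms(5) unfolding cycles_plus_isolated_def by auto
  have len: "int (length cs) = theta E" using cs(1) theta_nonneg[OF assms(1)] by simp
  have "rank (wmat ?D ?one) + 2 * length cs \<le> rank (wmat ?D \<phi>)"
  proof (rule rank_ge_disjoint_cycles)
    show "simple_graph ?D" "gains ?D \<phi>" "gains ?D ?one"
      using assms(1,2) by (simp_all add: simple_graph_restr gains_restr gains_one)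
    show "theta ?D \<le> int (length cs)" using theta_restr_le[OF assms(1)] len by simp
    show "set (cs ! i) \<inter> set (cs ! j) = {}" if "i < length cs" "j < length cs" "i \<noteq> j" for i j
      using cs(3) that by blast
    fix c assume c: "c \<in> set cs"
    obtain i where i: "i < length cs" "c = cs ! i" using c by (auto simp: in_set_conv_nth)
    have cE: "is_cycle E c" and cD: "is_cycle ?D c"
      using cs(2)[OF c] by (simp_all add: is_cycle_restr)
    \<comment> \<open>The edge lies on some listed cycle through \<open>v\<close>, and disjointness
      makes that cycle \<open>c\<close>.\<close>
    have "{v, u} \<in> cycle_edges c" if v: "v \<in> set c" and vu: "?D v u" for v u
    proof -
      have "{v, u} \<in> {{u, v} | u v. E u v \<and> u \<in> S \<and> v \<in> S}" using vu unfolding restr_def by blast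
      then obtain c' where c': "c' \<in> set cs" "{v, u} \<in> cycle_edges c'" unfolding cs(4) by blast
      then obtain j where j: "j < length cs" "c' = cs ! j" by (auto simp: in_set_conv_nth)
      have "is_cycle E c'" using cs(2) c' by blast
      then have "v \<in> set c'" using cycle_edges_subset_set[OF _ c'(2)] by blast
      then have "i = j" using cs(3)[OF i(1) j(1)] v i j by blast
      then show ?thesis using c' i j by simp
    qed
    then have "closed_cycle ?D c" using cD by (simp add: closed_cycle_def)
    moreover have "type_B \<phi> c" "length c mod 4 = 0" using types[OF cE] by auto
    \<comment> \<open>Half the length is even, so the critical sign is 1 and the constant weight 1
      is of type A.\<close>
    then have "length c = 2 * (length c div 2)" "even (length c div 2)" by (auto simp: type_B_def)
    then have "length c = 2 * (length c div 2) \<and> gain_prod \<phi> c \<noteq> (- 1) ^ (length c div 2) \<and>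
      gain_prod ?one c = (- 1) ^ (length c div 2)"
      using \<open>type_B \<phi> c\<close> by (simp add: type_B_def cycle_gain_def gain_prod_def)
    ultimately show "closed_cycle ?D c \<and> (\<exists>m. length c = 2 * m \<and>
      gain_prod \<phi> c \<noteq> (- 1) ^ m \<and> gain_prod ?one c = (- 1) ^ m)" by blast
  qed
  then show ?thesis
    using delta_steps_rank[OF assms(1,2) gains_one[where 'b = real] assms(4)] len
      rank_le_rank_theta[OF assms(1,2) gains_one[where 'b = real]]
    unfolding tight_def by linarith
qed

theorem theorem4p9:
  fixes E :: "'n::finite \<Rightarrow> 'n \<Rightarrow> bool" and \<phi> :: "'n \<Rightarrow> 'n \<Rightarrow> complex"
  assumes "simple_graph E" and "gain_function E \<phi>"
  shows "int (rank (gain_adj E \<phi>)) = int (rank (adj E)) + 2 * theta E \<longleftrightarrow>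
    ((\<forall>c1 c2. is_cycle E c1 \<and> is_cycle E c2 \<and> cycle_edges c1 \<noteq> cycle_edges c2
         \<longrightarrow> set c1 \<inter> set c2 = {}) \<and>
     (\<forall>c. is_cycle E c \<longrightarrow> type_B \<phi> c \<and> length c mod 4 = 0) \<and>
     (\<exists>S0. crucial_subgraph E S0 \<and> cycles_plus_isolated E S0 (nat (theta E))))"
proof -
  have g: "gains E \<phi>" by (rule gains_gain_function[OF assms(2)])
  have "int (rank (gain_adj E \<phi>)) = int (rank (adj E)) + 2 * theta E \<longleftrightarrow>
      tight E \<phi> (\<lambda>_ _. 1 :: real)"
    by (simp add: tight_def gain_adj_wmat adj_wmat)
  then show ?thesis
    using tight_imp_conditions[OF assms(1) g] conditions_imp_tight[OF assms(1) g]
    unfolding crucial_subgraph_def by blast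
qed

end
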